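(* There exists an absolute constant $K>0$ such that the following holds. Let $n\ge2$ and $d_n\ge1$ be integers, let $f:\{0,1,\ldots,d_n\}^{n-1}\to\mathbb{R}$, and let $C_1,C_2\ge0$ be constants with $C_1+C_2>0$ such that: 1. For any $i\in[n-1]$ and $x_1,\ldots,x_i,x_i',x_{i+1},\ldots,x_{n-1}\in\{0,1,\ldots,d_n\}$, $$|f(x_1,\ldots,x_i,\ldots,x_{n-1})-f(x_1,\ldots,x_i',\ldots,x_{n-1})|\le C_1.$$ 2. For all $0\le k\le\lfloor n/2\rfloor$ and all $I,J\in\binom{[n-k]}{k}$ with $|I\Delta J|=2$, $$\Big|\big(\mathbb{E}[f(X_I)]-\mathbb{E}[f(X_{\tau(I)})]\big)-\big(\mathbb{E}[f(X_J)]-\mathbb{E}[f(X_{\tau(J)})]\big)\Big|\le C_2,$$ where $X_I,X_{\tau(I)},X_J,X_{\tau(J)}$ are uniformly distributed on $I^{(n)},\tau(I)^{(n)},J^{(n)},\tau(J)^{(n)}$, respectively. Let $X$ be uniformly distributed on $\mathcal{SB}_n$. Then for every $r>0$, $$\mathbb{P}\big(|f(X)-\mathbb{E}[f(X)]|\ge r\big)\le2\exp\left(-\frac{r^2}{nK(C_1+C_2)^2}\right).$$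
   Context: $[m]=\{1,\ldots,m\}$, $\binom{[m]}{k}$ is the family of all $k$-element subsets of $[m]$, and $\Delta$ denotes symmetric difference. For $I=\{x_1<\cdots<x_k\}\subset\mathbb{N}$, $\tau(I)=\{x_1,x_2+1,\ldots,x_k+k-1\}$ (so $\tau(I)\subseteq[n-1]$ if $I\in\binom{[n-k]}{k}$). For $I\subseteq[n-1]$, $$I^{(n)}=\{(x_1,\ldots,x_{n-1}): x_i=0\text{ if }i\notin I,\ x_i\in\{1,\ldots,d_n\}\text{ if }i\in I\}.$$ $\mathcal{SB}_n=\{(x_1,\ldots,x_{n-1})\in\{0,1,\ldots,d_n\}^{n-1}:x_ix_{i+1}=0\text{ for }1\le i\le n-2\}$. *)

theory Defs
  imports "HOL-Probability.Probability" "HOL-Library.Ramsey"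
begin

text \<open>Vectors \<open>(x_1, \<dots>, x_{n-1})\<close> with entries in \<open>{0, \<dots>, d}\<close> are rendered as functions
  on the index set \<open>{1..n-1}\<close> that are extensional (\<open>undefined\<close> off the index set), so that each
  vector is represented exactly once.\<close>

definition cube :: "nat \<Rightarrow> nat \<Rightarrow> (nat \<Rightarrow> nat) set" where
  "cube n d = {1..n-1} \<rightarrow>\<^sub>E {0..d}"

definition SB :: "nat \<Rightarrow> nat \<Rightarrow> (nat \<Rightarrow> nat) set" where
  "SB n d = {x \<in> cube n d. \<forall>i\<in>{1..n-2}. x i * x (i + 1) = 0}"

text \<open>The set \<open>I^(n)\<close>, for \<open>I \<subseteq> {1..n-1}\<close>.\<close>

definition supp_box :: "nat \<Rightarrow> nat \<Rightarrow> nat set \<Rightarrow> (nat \<Rightarrow> nat) set" where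
  "supp_box n d I =
     {x \<in> cube n d. \<forall>i\<in>{1..n-1}. if i \<in> I then x i \<in> {1..d} else x i = 0}"

text \<open>List positions count from 0, so the shift \<open>j - 1\<close> of the \<open>j\<close>-th smallest element
  is its position in the sorted list. Only meaningful for finite sets.\<close>

definition tau :: "nat set \<Rightarrow> nat set" where
  "tau I = {sorted_list_of_set I ! j + j | j. j < card I}"

definition unif_expectation :: "'a set \<Rightarrow> ('a \<Rightarrow> real) \<Rightarrow> real" where
  "unif_expectation S f = measure_pmf.expectation (pmf_of_set S) f"

definition unif_prob :: "'a set \<Rightarrow> ('a \<Rightarrow> bool) \<Rightarrow> real" where
  "unif_prob S P = measure_pmf.prob (pmf_of_set S) {x. P x}"

end

theory Submission
  imports Defs
begin

text \<open>The vector \<open>X\<close> is generated in three steps: first the number \<open>k\<close> of nonzero coordinates, then the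
  support, which given \<open>k\<close> is uniform among the \<open>k\<close>-subsets of \<open>{1..n-1}\<close> without neighbours, and then
  the nonzero entries. Accordingly \<open>f X - E (f X)\<close> is split into the fluctuation of \<open>f\<close> given the
  support, the fluctuation of the conditional mean given \<open>k\<close>, and the fluctuation of the mean \<open>h k\<close>
  of \<open>f\<close> on level \<open>k\<close>. For each part the logarithm of the moment generating function is shown to be
  at most a constant times \<open>l\<^sup>2 n (C1 + C2)\<^sup>2\<close>. By \<open>sub_gaussian_tower\<close> these bounds add up, and the
  Chernoff bound \<open>sub_gaussian_tail\<close> gives the claim.

  Given the support, the entries are independent, and the first hypothesis allows the martingale
  argument \<open>sub_gaussian_PiE\<close>. Given \<open>k\<close>, the support is the shift \<open>tau I\<close> of a uniform \<open>k\<close>-subset \<open>I\<close> of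
  \<open>{1..n-k}\<close> (\<open>bij_betw_tau\<close>). The second hypothesis says that an exchange of one element of \<open>I\<close> changes
  \<open>E (f X_(tau I))\<close> by at most \<open>C2\<close> more than \<open>E (f X_I)\<close>, which changes by at most \<open>2 C1\<close>. So the
  martingale argument for slices, \<open>sub_gaussian_nsets\<close>, applies.

  For the last part, a few exchanges and one insertion relate the levels \<open>k\<close> and \<open>k + 1\<close>, whence \<open>h\<close> is
  Lipschitz (\<open>level_mean_step\<close>). A symmetrisation (\<open>sub_gaussian_lipschitz\<close>) reduces the claim to the
  variable \<open>k\<close> itself. Its weights \<open>d^k (n - k choose k)\<close>, divided by the binomial coefficients of
  \<open>n div 2\<close>, are log-concave. Hence \<open>k\<close> is dominated in the convex order by a binomial
  variable with the same mean (\<open>ultra_log_concave_mgf\<close>), and Hoeffding's lemma applies.\<close>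

section \<open>Averages over finite sets\<close>

text \<open>The mean of \<open>f\<close> under the uniform distribution on a finite set \<open>S\<close>; it is \<open>0\<close> if \<open>S\<close> is
  empty or infinite.\<close>
definition avg :: "'a set \<Rightarrow> ('a \<Rightarrow> real) \<Rightarrow> real" where
  "avg S f = (\<Sum>x\<in>S. f x) / real (card S)"

lemma avg_empty [simp]: "avg {} f = 0"
  by (simp add: avg_def)

lemma unif_expectation_eq_avg:
  "finite S \<Longrightarrow> S \<noteq> {} \<Longrightarrow> unif_expectation S f = avg S f"
  by (simp add: unif_expectation_def integral_pmf_of_set avg_def)

lemma avg_cong: "S = T \<Longrightarrow> (\<And>x. x \<in> T \<Longrightarrow> f x = g x) \<Longrightarrow> avg S f = avg T g"
  by (simp add: avg_def)

lemma avg_mono: "(\<And>x. x \<in> S \<Longrightarrow> f x \<le> g x) \<Longrightarrow> avg S f \<le> avg S g"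
  by (auto simp: avg_def intro!: divide_right_mono sum_mono)

lemma avg_const: "finite S \<Longrightarrow> S \<noteq> {} \<Longrightarrow> avg S (\<lambda>_. c) = c"
  by (simp add: avg_def)

lemma avg_mult_left: "avg S (\<lambda>x. c * f x) = c * avg S f"
  by (simp add: avg_def sum_distrib_left)

lemma avg_mult_right: "avg S (\<lambda>x. f x * c) = avg S f * c"
  by (simp add: avg_def sum_distrib_right)

lemma avg_add: "avg S (\<lambda>x. f x + g x) = avg S f + avg S g"
  by (simp add: avg_def sum.distrib add_divide_distrib)

lemma avg_diff: "avg S (\<lambda>x. f x - g x) = avg S f - avg S g"
  by (simp add: avg_def sum_subtractf diff_divide_distrib)

lemma avg_nonneg: "(\<And>x. x \<in> S \<Longrightarrow> 0 \<le> f x) \<Longrightarrow> 0 \<le> avg S f"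
  by (auto simp: avg_def intro!: divide_nonneg_nonneg sum_nonneg)

lemma avg_abs_diff_le:
  assumes "0 \<le> C" and "\<And>x. x \<in> S \<Longrightarrow> \<bar>f x - g x\<bar> \<le> C"
  shows "\<bar>avg S f - avg S g\<bar> \<le> C"
proof (cases "finite S \<and> S \<noteq> {}")
  case True
  have "f x - g x \<le> C" "g x - f x \<le> C" if "x \<in> S" for x
    using assms(2)[OF that] by linarith+
  then have "avg S (\<lambda>x. f x - g x) \<le> avg S (\<lambda>_. C)" "avg S (\<lambda>x. g x - f x) \<le> avg S (\<lambda>_. C)"
    by (auto intro: avg_mono)
  then show ?thesis
    using True by (simp add: avg_diff avg_const abs_le_iff)
next
  case False
  then show ?thesis using assms(1) by (auto simp: avg_def)
qed

lemma avg_swap: "avg S (\<lambda>x. avg T (\<lambda>y. h x y)) = avg T (\<lambda>y. avg S (\<lambda>x. h x y))"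
  unfolding avg_def sum_divide_distrib[symmetric] by (subst sum.swap) (simp add: mult.commute)

lemma avg_bij: "bij_betw g T S \<Longrightarrow> avg S f = avg T (f \<circ> g)"
  by (simp add: avg_def sum.reindex_bij_betw bij_betw_same_card[symmetric])

text \<open>If all fibres of \<open>\<phi>\<close> have the same size, \<open>\<phi>\<close> pushes the uniform distribution on \<open>S\<close> forward to
  the uniform distribution on \<open>T\<close>.\<close>
lemma avg_equidistributed:
  assumes "finite S" "\<phi> ` S \<subseteq> T" "finite T"
    and "\<And>t. t \<in> T \<Longrightarrow> card {x \<in> S. \<phi> x = t} = c" and "c > 0"
  shows "avg S (F \<circ> \<phi>) = avg T F"
proof -
  have 1: "(\<Sum>x\<in>S. h (\<phi> x)) = real c * (\<Sum>t\<in>T. h t)" for h :: "_ \<Rightarrow> real"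
  proof -
    have "(\<Sum>x\<in>S. h (\<phi> x)) = (\<Sum>t\<in>T. \<Sum>x\<in>{x \<in> S. \<phi> x = t}. h (\<phi> x))"
      by (rule sum.group[symmetric]) (use assms in auto)
    also have "\<dots> = (\<Sum>t\<in>T. real c * h t)"
      using assms by (intro sum.cong) auto
    finally show ?thesis by (simp add: sum_distrib_left)
  qed
  have "real (card S) = real c * real (card T)"
    using 1[of "\<lambda>_. 1"] by simp
  then show ?thesis
    using 1[of F] \<open>c > 0\<close> by (simp add: avg_def)
qed

text \<open>A biregular relation is a coupling of the two uniform distributions: a uniformly chosen related
  pair has uniform marginals.\<close>
lemma avg_coupling:
  assumes "finite S" "finite T" "R \<subseteq> S \<times> T"
    and "\<And>s. s \<in> S \<Longrightarrow> card {t \<in> T. (s, t) \<in> R} = p" "p > 0"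
    and "\<And>t. t \<in> T \<Longrightarrow> card {s \<in> S. (s, t) \<in> R} = q" "q > 0"
    and "0 \<le> C" and "\<And>s t. (s, t) \<in> R \<Longrightarrow> \<bar>f s - g t\<bar> \<le> C"
  shows "\<bar>avg S f - avg T g\<bar> \<le> C"
proof -
  have fin: "finite R"
    using assms(1-3) finite_subset by blast
  have "card {x \<in> R. fst x = s} = p" if "s \<in> S" for s
  proof -
    have "{x \<in> R. fst x = s} = Pair s ` {t \<in> T. (s, t) \<in> R}"
      using assms(3) by force
    then show ?thesis using assms(4)[OF that] by (simp add: card_image inj_on_def)
  qed
  then have 1: "avg R (f \<circ> fst) = avg S f"
    by (intro avg_equidistributed[where c = p]) (use assms fin in auto)
  have "card {x \<in> R. snd x = t} = q" if "t \<in> T" for t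
  proof -
    have "{x \<in> R. snd x = t} = (\<lambda>s. (s, t)) ` {s \<in> S. (s, t) \<in> R}"
      using assms(3) by force
    then show ?thesis using assms(6)[OF that] by (simp add: card_image inj_on_def)
  qed
  then have 2: "avg R (g \<circ> snd) = avg T g"
    by (intro avg_equidistributed[where c = q]) (use assms fin in auto)
  show ?thesis
    unfolding 1[symmetric] 2[symmetric] using assms by (intro avg_abs_diff_le) auto
qed

text \<open>The law of total expectation, for conditioning on \<open>\<pi>\<close>.\<close>
lemma avg_fibres:
  assumes "finite S"
  shows "avg S f = avg S (\<lambda>x. avg {y \<in> S. \<pi> y = \<pi> x} f)"
proof -
  have "(\<Sum>x\<in>S. avg {y \<in> S. \<pi> y = \<pi> x} f)
      = (\<Sum>t\<in>\<pi> ` S. \<Sum>x\<in>{y \<in> S. \<pi> y = t}. avg {y \<in> S. \<pi> y = \<pi> x} f)"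
    using assms by (rule sum.image_gen)
  also have "\<dots> = (\<Sum>t\<in>\<pi> ` S. \<Sum>x\<in>{y \<in> S. \<pi> y = t}. f x)"
  proof (rule sum.cong[OF refl])
    fix t assume "t \<in> \<pi> ` S"
    then have "{y \<in> S. \<pi> y = t} \<noteq> {}" by auto
    moreover have "(\<Sum>x\<in>{y \<in> S. \<pi> y = t}. avg {y \<in> S. \<pi> y = \<pi> x} f)
        = (\<Sum>x\<in>{y \<in> S. \<pi> y = t}. avg {y \<in> S. \<pi> y = t} f)"
      by (intro sum.cong) auto
    ultimately show "(\<Sum>x\<in>{y \<in> S. \<pi> y = t}. avg {y \<in> S. \<pi> y = \<pi> x} f)
        = (\<Sum>x\<in>{y \<in> S. \<pi> y = t}. f x)"
      using assms by (simp add: avg_def)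
  qed
  also have "\<dots> = (\<Sum>x\<in>S. f x)"
    using assms by (rule sum.image_gen[symmetric])
  finally show ?thesis by (simp add: avg_def)
qed

lemma avg_fibre_close:
  assumes "finite S" "x\<^sub>0 \<in> S" "0 \<le> C"
    and "\<And>x. x \<in> S \<Longrightarrow> \<bar>avg {y \<in> S. \<pi> y = \<pi> x} f - avg {y \<in> S. \<pi> y = \<pi> x\<^sub>0} f\<bar> \<le> C"
  shows "\<bar>avg S f - avg {y \<in> S. \<pi> y = \<pi> x\<^sub>0} f\<bar> \<le> C"
proof -
  have "\<bar>avg S (\<lambda>x. avg {y \<in> S. \<pi> y = \<pi> x} f) - avg S (\<lambda>_. avg {y \<in> S. \<pi> y = \<pi> x\<^sub>0} f)\<bar> \<le> C"
    using assms by (intro avg_abs_diff_le) auto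
  moreover have "avg S (\<lambda>_. avg {y \<in> S. \<pi> y = \<pi> x\<^sub>0} f) = avg {y \<in> S. \<pi> y = \<pi> x\<^sub>0} f"
    using assms by (intro avg_const) auto
  ultimately show ?thesis
    using avg_fibres[OF assms(1), of f \<pi>] by simp
qed

section \<open>Sub-Gaussian functions\<close>

text \<open>The centred moment generating function of \<open>f\<close> under the uniform distribution on \<open>S\<close> is at most
  that of a Gaussian with variance \<open>2 v\<close>. The mean is subtracted exactly, so that the bounds
  for a conditional distribution and for the conditional mean add up.\<close>
definition sub_gaussian :: "'a set \<Rightarrow> ('a \<Rightarrow> real) \<Rightarrow> real \<Rightarrow> bool" where
  "sub_gaussian S f v \<longleftrightarrow>
     (\<forall>l::real. avg S (\<lambda>x. exp (l * (f x - avg S f))) \<le> exp (l\<^sup>2 * v))"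

lemma sub_gaussian_mono: "sub_gaussian S f v \<Longrightarrow> v \<le> w \<Longrightarrow> sub_gaussian S f w"
  unfolding sub_gaussian_def by (meson exp_le_cancel_iff mult_left_mono order_trans zero_le_power2)

lemma sub_gaussian_bij:
  assumes "bij_betw g T S" "sub_gaussian T (f \<circ> g) v"
  shows "sub_gaussian S f v"
  using assms(2) unfolding sub_gaussian_def avg_bij[OF assms(1)] by (simp add: comp_def)

lemma sub_gaussian_equidistributed:
  assumes "finite S" "\<phi> ` S \<subseteq> T" "finite T"
    and "\<And>t. t \<in> T \<Longrightarrow> card {x \<in> S. \<phi> x = t} = c" and "c > 0"
    and "sub_gaussian T F v"
  shows "sub_gaussian S (F \<circ> \<phi>) v"
proof -
  have eq: "avg S (G \<circ> \<phi>) = avg T G" for G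
    by (rule avg_equidistributed[where c = c]) (use assms in auto)
  show ?thesis
    unfolding sub_gaussian_def eq
    using assms(6) eq[of "\<lambda>t. exp (_ * (F t - avg T F))"]
    by (simp add: comp_def sub_gaussian_def)
qed

text \<open>One step of the martingale method: condition on \<open>\<pi>\<close>, bound the conditional fluctuation on each
  fibre, and then the fluctuation of the conditional mean.\<close>
lemma sub_gaussian_tower:
  assumes fin: "finite S"
    and fibres: "\<And>x. x \<in> S \<Longrightarrow> sub_gaussian {y \<in> S. \<pi> y = \<pi> x} f v"
    and base: "sub_gaussian S (\<lambda>x. avg {y \<in> S. \<pi> y = \<pi> x} f) w"
  shows "sub_gaussian S f (v + w)"
  unfolding sub_gaussian_def
proof
  fix l :: real
  define F where "F x = avg {y \<in> S. \<pi> y = \<pi> x} f" for x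
  have m: "avg S F = avg S f"
    unfolding F_def using avg_fibres[OF fin] by metis
  have "avg S (\<lambda>x. exp (l * (f x - avg S f)))
      = avg S (\<lambda>x. avg {y \<in> S. \<pi> y = \<pi> x} (\<lambda>y. exp (l * (f y - avg S f))))"
    by (rule avg_fibres[OF fin])
  also have "\<dots> \<le> avg S (\<lambda>x. exp (l\<^sup>2 * v) * exp (l * (F x - avg S F)))"
  proof (rule avg_mono)
    fix x assume x: "x \<in> S"
    have "avg {y \<in> S. \<pi> y = \<pi> x} (\<lambda>y. exp (l * (f y - avg S f)))
        = avg {y \<in> S. \<pi> y = \<pi> x} (\<lambda>y. exp (l * (f y - F x)) * exp (l * (F x - avg S F)))"
      by (intro avg_cong) (auto simp: m mult_exp_exp algebra_simps)
    also have "\<dots> = avg {y \<in> S. \<pi> y = \<pi> x} (\<lambda>y. exp (l * (f y - F x))) * exp (l * (F x - avg S F))"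
      by (rule avg_mult_right)
    also have "\<dots> \<le> exp (l\<^sup>2 * v) * exp (l * (F x - avg S F))"
      using fibres[OF x] unfolding F_def sub_gaussian_def by (intro mult_right_mono) auto
    finally show "avg {y \<in> S. \<pi> y = \<pi> x} (\<lambda>y. exp (l * (f y - avg S f)))
      \<le> exp (l\<^sup>2 * v) * exp (l * (F x - avg S F))" .
  qed
  also have "\<dots> = exp (l\<^sup>2 * v) * avg S (\<lambda>x. exp (l * (F x - avg S F)))"
    by (rule avg_mult_left)
  also have "\<dots> \<le> exp (l\<^sup>2 * v) * exp (l\<^sup>2 * w)"
    using base unfolding F_def[abs_def, symmetric] sub_gaussian_def by (intro mult_left_mono) auto
  finally show "avg S (\<lambda>x. exp (l * (f x - avg S f))) \<le> exp (l\<^sup>2 * (v + w))"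
    by (simp add: mult_exp_exp algebra_simps)
qed

text \<open>Hoeffding's lemma for finitely supported distributions and all real \<open>l\<close>.\<close>
lemma Hoeffding_pmf:
  fixes f :: "'a \<Rightarrow> real"
  assumes fin: "finite (set_pmf p)" and m: "measure_pmf.expectation p f = m"
    and range: "\<And>x. x \<in> set_pmf p \<Longrightarrow> a \<le> f x \<and> f x \<le> b"
  shows "measure_pmf.expectation p (\<lambda>x. exp (l * (f x - m))) \<le> exp (l\<^sup>2 * (b - a)\<^sup>2 / 8)"
proof -
  have pos: "measure_pmf.expectation p (\<lambda>x. exp (l * (f x - m))) \<le> exp (l\<^sup>2 * (b - a)\<^sup>2 / 8)"
    if "l > 0" and m: "measure_pmf.expectation p f = m"
      and range: "\<And>x. x \<in> set_pmf p \<Longrightarrow> a \<le> f x \<and> f x \<le> b"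
    for l m a b :: real and f :: "'a \<Rightarrow> real"
  proof -
    interpret interval_bounded_random_variable "measure_pmf p" "\<lambda>x. f x - m" "a - m" "b - m"
      by unfold_locales (use range in \<open>auto simp: AE_measure_pmf_iff\<close>)
    have "measure_pmf.expectation p (\<lambda>x. f x - m) = 0"
      using m fin by (subst Bochner_Integration.integral_diff) (auto intro: integrable_measure_pmf_finite)
    from Hoeffdings_lemma_nn_integral_0[OF \<open>l > 0\<close> this]
    have "(\<integral>\<^sup>+ x. ennreal (exp (l * (f x - m))) \<partial>p) \<le> ennreal (exp (l\<^sup>2 * (b - a)\<^sup>2 / 8))"
      by simp
    moreover have "(\<integral>\<^sup>+ x. ennreal (exp (l * (f x - m))) \<partial>p)
        = ennreal (measure_pmf.expectation p (\<lambda>x. exp (l * (f x - m))))"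
      by (rule nn_integral_eq_integral) (auto intro: integrable_measure_pmf_finite[OF fin])
    ultimately show ?thesis by simp
  qed
  consider "l > 0" | "l = 0" | "l < 0" by linarith
  then show ?thesis
  proof cases
    case 1
    then show ?thesis using pos m range by blast
  next
    case 2
    then show ?thesis by simp
  next
    case 3
    have "measure_pmf.expectation p (\<lambda>x. exp (- l * (- f x - - m)))
        \<le> exp ((- l)\<^sup>2 * (- a - - b)\<^sup>2 / 8)"
      by (rule pos) (use 3 m range in auto)
    then show ?thesis by (simp add: algebra_simps)
  qed
qed

lemma sub_gaussian_bounded_range:
  assumes fin: "finite S" and C: "\<And>x y. x \<in> S \<Longrightarrow> y \<in> S \<Longrightarrow> \<bar>f x - f y\<bar> \<le> C"
  shows "sub_gaussian S f (C\<^sup>2 / 8)"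
proof (cases "S = {}")
  case True
  then show ?thesis by (simp add: sub_gaussian_def)
next
  case False
  define a where "a = Min (f ` S)"
  have "a \<in> f ` S" unfolding a_def using fin False by (intro Min_in) auto
  then obtain x\<^sub>0 where x0: "x\<^sub>0 \<in> S" "a = f x\<^sub>0" by auto
  have "a \<le> f x \<and> f x \<le> a + C" if "x \<in> S" for x
    using C[OF that x0(1)] fin that unfolding x0(2)[symmetric] by (auto simp: a_def)
  then have "measure_pmf.expectation (pmf_of_set S) (\<lambda>x. exp (l * (f x - avg S f)))
      \<le> exp (l\<^sup>2 * ((a + C) - a)\<^sup>2 / 8)" for l
    using fin False by (intro Hoeffding_pmf) (auto simp: integral_pmf_of_set avg_def)
  then show ?thesis
    using fin False by (simp add: integral_pmf_of_set avg_def sub_gaussian_def)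
qed

text \<open>If the increments of \<open>F\<close> are dominated by those of \<open>P\<close>, then \<open>F\<close> inherits the bound for \<open>P\<close>. By
  Jensen's inequality it suffices to consider \<open>F X - F Y\<close> for an independent copy \<open>Y\<close> of \<open>X\<close>. This
  difference is symmetric, so its exponential moment is the mean of a \<open>cosh\<close>, which is monotone in
  the absolute value of its argument.\<close>
lemma sub_gaussian_lipschitz:
  assumes C: "0 \<le> C"
    and dom: "\<And>x y. x \<in> S \<Longrightarrow> y \<in> S \<Longrightarrow> \<bar>F x - F y\<bar> \<le> C * \<bar>P x - P y\<bar>"
    and P: "sub_gaussian S P v"
  shows "sub_gaussian S F (2 * C\<^sup>2 * v)"
  unfolding sub_gaussian_def
proof
  fix l :: real
  show "avg S (\<lambda>x. exp (l * (F x - avg S F))) \<le> exp (l\<^sup>2 * (2 * C\<^sup>2 * v))"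
  proof (cases "finite S \<and> S \<noteq> {}")
    case False
    then show ?thesis by (auto simp: avg_def)
  next
    case True
    have jensen: "exp (avg S g) \<le> avg S (\<lambda>y. exp (g y))" for g
    proof -
      have "exp (avg S g) * (1 + avg S (\<lambda>y. g y - avg S g)) = exp (avg S g)"
        using True by (simp add: avg_diff avg_const)
      moreover have "exp (avg S g) * (1 + avg S (\<lambda>y. g y - avg S g))
          = avg S (\<lambda>y. exp (avg S g) * (1 + (g y - avg S g)))"
        using True by (simp add: avg_mult_left avg_add avg_const)
      moreover have "\<dots> \<le> avg S (\<lambda>y. exp (avg S g) * exp (g y - avg S g))"
        by (intro avg_mono mult_left_mono) (auto simp: exp_ge_add_one_self)
      moreover have "\<dots> = avg S (\<lambda>y. exp (g y))"
        by (simp add: mult_exp_exp)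
      ultimately show ?thesis by simp
    qed
    have symm: "avg S (\<lambda>x. avg S (\<lambda>y. exp (c * (Q x - Q y))))
        = avg S (\<lambda>x. avg S (\<lambda>y. cosh (c * (Q x - Q y))))" for c :: real and Q
    proof -
      have "avg S (\<lambda>x. avg S (\<lambda>y. exp (c * (Q x - Q y))))
          = avg S (\<lambda>x. avg S (\<lambda>y. exp (c * (Q y - Q x))))"
        by (rule avg_swap)
      also have "\<dots> = avg S (\<lambda>x. avg S (\<lambda>y. exp (- (c * (Q x - Q y)))))"
        by (simp add: algebra_simps)
      finally have "avg S (\<lambda>x. avg S (\<lambda>y. exp (c * (Q x - Q y))))
          = 1 / 2 * (avg S (\<lambda>x. avg S (\<lambda>y. exp (c * (Q x - Q y))))
                   + avg S (\<lambda>x. avg S (\<lambda>y. exp (- (c * (Q x - Q y))))))"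
        by simp
      also have "\<dots> = avg S (\<lambda>x. avg S (\<lambda>y. 1 / 2 * (exp (c * (Q x - Q y)) + exp (- (c * (Q x - Q y))))))"
        by (simp only: avg_mult_left avg_add)
      finally show ?thesis
        by (simp add: cosh_field_def)
    qed
    have "avg S (\<lambda>x. exp (l * (F x - avg S F)))
        = avg S (\<lambda>x. exp (avg S (\<lambda>y. l * (F x - F y))))"
      using True by (simp add: avg_mult_left avg_diff avg_const)
    also have "\<dots> \<le> avg S (\<lambda>x. avg S (\<lambda>y. exp (l * (F x - F y))))"
      by (intro avg_mono jensen)
    also have "\<dots> = avg S (\<lambda>x. avg S (\<lambda>y. cosh (l * (F x - F y))))"
      by (rule symm)
    also have "\<dots> \<le> avg S (\<lambda>x. avg S (\<lambda>y. cosh ((l * C) * (P x - P y))))"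
    proof (intro avg_mono)
      fix x y assume "x \<in> S" "y \<in> S"
      then have "\<bar>l\<bar> * \<bar>F x - F y\<bar> \<le> \<bar>l\<bar> * (C * \<bar>P x - P y\<bar>)"
        using dom by (intro mult_left_mono) auto
      then have "cosh \<bar>l * (F x - F y)\<bar> \<le> cosh \<bar>(l * C) * (P x - P y)\<bar>"
        using C by (subst cosh_real_nonneg_le_iff) (auto simp: abs_mult mult.assoc)
      then show "cosh (l * (F x - F y)) \<le> cosh ((l * C) * (P x - P y))" by simp
    qed
    also have "\<dots> = avg S (\<lambda>x. avg S (\<lambda>y. exp ((l * C) * (P x - P y))))"
      by (rule symm[symmetric])
    also have "\<dots> = avg S (\<lambda>x. exp ((l * C) * (P x - avg S P))
                       * avg S (\<lambda>y. exp ((- (l * C)) * (P y - avg S P))))"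
      by (simp add: avg_mult_left[symmetric] mult_exp_exp algebra_simps)
    also have "\<dots> = avg S (\<lambda>x. exp ((l * C) * (P x - avg S P)))
                       * avg S (\<lambda>y. exp ((- (l * C)) * (P y - avg S P)))"
      by (rule avg_mult_right)
    also have "\<dots> \<le> exp ((l * C)\<^sup>2 * v) * exp ((- (l * C))\<^sup>2 * v)"
      using P[unfolded sub_gaussian_def, rule_format, of "l * C"]
        P[unfolded sub_gaussian_def, rule_format, of "- (l * C)"]
      by (intro mult_mono avg_nonneg) auto
    also have "\<dots> = exp (l\<^sup>2 * (2 * C\<^sup>2 * v))"
      by (simp add: mult_exp_exp power_mult_distrib algebra_simps)
    finally show ?thesis .
  qed
qed

lemma sub_gaussian_tail:
  assumes fin: "finite S" "S \<noteq> {}" and sg: "sub_gaussian S f v" and v: "v > 0" and r: "r > 0"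
  shows "unif_prob S (\<lambda>x. r \<le> \<bar>f x - avg S f\<bar>) \<le> 2 * exp (- (r\<^sup>2 / (4 * v)))"
proof -
  \<comment> \<open>The minimiser of \<open>l\<^sup>2 v - l r\<close>.\<close>
  define l where "l = r / (2 * v)"
  let ?g = "\<lambda>x. exp (l * (f x - avg S f)) + exp (- l * (f x - avg S f))"
  have "l > 0" using v r by (simp add: l_def)
  have "unif_prob S (\<lambda>x. r \<le> \<bar>f x - avg S f\<bar>) = avg S (\<lambda>x. of_bool (r \<le> \<bar>f x - avg S f\<bar>))"
    using fin by (simp add: unif_prob_def measure_pmf_of_set avg_def Int_def)
  also have "\<dots> \<le> avg S (\<lambda>x. exp (- l * r) * ?g x)"
  proof (rule avg_mono)
    fix x assume "x \<in> S"
    show "of_bool (r \<le> \<bar>f x - avg S f\<bar>) \<le> exp (- l * r) * ?g x"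
    proof (cases "r \<le> \<bar>f x - avg S f\<bar>")
      case True
      then have "l * r \<le> l * \<bar>f x - avg S f\<bar>" using \<open>l > 0\<close> by simp
      then have "exp (l * r) \<le> exp (l * \<bar>f x - avg S f\<bar>)" by simp
      also have "\<dots> \<le> ?g x"
        by (cases "f x \<ge> avg S f") (auto simp: abs_if algebra_simps)
      finally have "exp (- l * r) * exp (l * r) \<le> exp (- l * r) * ?g x"
        by (intro mult_left_mono) auto
      then show ?thesis using True by (simp add: mult_exp_exp)
    qed (auto intro: add_nonneg_nonneg)
  qed
  also have "\<dots> = exp (- l * r) * (avg S (\<lambda>x. exp (l * (f x - avg S f)))
      + avg S (\<lambda>x. exp (- l * (f x - avg S f))))"
    by (simp only: avg_mult_left avg_add)
  also have "\<dots> \<le> exp (- l * r) * (exp (l\<^sup>2 * v) + exp ((- l)\<^sup>2 * v))"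
    using sg[unfolded sub_gaussian_def, rule_format, of l]
      sg[unfolded sub_gaussian_def, rule_format, of "- l"]
    by (intro mult_left_mono add_mono) auto
  also have "\<dots> = 2 * exp (l\<^sup>2 * v - l * r)"
    by (simp add: mult_exp_exp[symmetric] exp_diff exp_minus field_simps)
  also have "l\<^sup>2 * v - l * r = - (r\<^sup>2 / (4 * v))"
    using v by (simp add: l_def field_simps power2_eq_square)
  finally show ?thesis .
qed

section \<open>Bounded differences on products and on slices\<close>

text \<open>McDiarmid's inequality, by conditioning on one coordinate at a time.\<close>
lemma sub_gaussian_PiE:
  assumes "finite A" "\<And>i. i \<in> A \<Longrightarrow> finite (B i)" "0 \<le> C"
    and "\<And>x i y. x \<in> Pi\<^sub>E A B \<Longrightarrow> i \<in> A \<Longrightarrow> y \<in> B i \<Longrightarrow> \<bar>f x - f (x(i := y))\<bar> \<le> C"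
  shows "sub_gaussian (Pi\<^sub>E A B) f (real (card A) * (C\<^sup>2 / 8))"
  using assms
proof (induction A arbitrary: f rule: finite_induct)
  case empty
  have "sub_gaussian {\<lambda>_. undefined} f (0\<^sup>2 / 8)"
    by (rule sub_gaussian_bounded_range) auto
  then show ?case by simp
next
  case (insert a A)
  let ?S = "Pi\<^sub>E (insert a A) B"
  have bij: "bij_betw (\<lambda>x. x(a := t)) (Pi\<^sub>E A B) {y \<in> ?S. y a = t}" if "t \<in> B a" for t
  proof (rule bij_betw_byWitness[where f' = "\<lambda>x. x(a := undefined)"])
    show "\<forall>x\<in>Pi\<^sub>E A B. (x(a := t))(a := undefined) = x"
    proof
      fix x assume "x \<in> Pi\<^sub>E A B"
      then have "x a = undefined" using insert.hyps(2) by (rule PiE_arb)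
      then show "(x(a := t))(a := undefined) = x" by auto
    qed
    show "(\<lambda>x. x(a := t)) ` Pi\<^sub>E A B \<subseteq> {y \<in> ?S. y a = t}"
      using that insert.hyps by (auto simp: PiE_iff extensional_def)
    show "(\<lambda>x. x(a := undefined)) ` {y \<in> ?S. y a = t} \<subseteq> Pi\<^sub>E A B"
      using insert.hyps by (auto simp: PiE_iff extensional_def)
  qed auto
  have "sub_gaussian ?S f (real (card A) * (C\<^sup>2 / 8) + C\<^sup>2 / 8)"
  proof (rule sub_gaussian_tower[where \<pi> = "\<lambda>x. x a"])
    show fin: "finite ?S"
      using insert by (intro finite_PiE) auto
    show "sub_gaussian {y \<in> ?S. y a = x a} f (real (card A) * (C\<^sup>2 / 8))" if x: "x \<in> ?S" for x
    proof (rule sub_gaussian_bij[OF bij])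
      show xa: "x a \<in> B a" using x by auto
      show "sub_gaussian (Pi\<^sub>E A B) (f \<circ> (\<lambda>y. y(a := x a))) (real (card A) * (C\<^sup>2 / 8))"
      proof (rule insert.IH)
        fix z i y assume z: "z \<in> Pi\<^sub>E A B" "i \<in> A" "y \<in> B i"
        have "z(a := x a) \<in> ?S" using z xa insert.hyps by (auto simp: PiE_iff extensional_def)
        then have "\<bar>f (z(a := x a)) - f ((z(a := x a))(i := y))\<bar> \<le> C"
          using insert.prems(3) z by blast
        moreover have "(z(a := x a))(i := y) = (z(i := y))(a := x a)"
          using z insert.hyps by (intro fun_upd_twist) auto
        ultimately show "\<bar>(f \<circ> (\<lambda>y. y(a := x a))) z - (f \<circ> (\<lambda>y. y(a := x a))) (z(i := y))\<bar> \<le> C"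
          by simp
      qed (use insert in auto)
    qed
    show "sub_gaussian ?S (\<lambda>x. avg {y \<in> ?S. y a = x a} f) (C\<^sup>2 / 8)"
    proof (rule sub_gaussian_bounded_range[OF fin])
      fix x y assume xy: "x \<in> ?S" "y \<in> ?S"
      then have a: "x a \<in> B a" "y a \<in> B a" by auto
      show "\<bar>avg {y \<in> ?S. y a = x a} f - avg {z \<in> ?S. z a = y a} f\<bar> \<le> C"
        unfolding avg_bij[OF bij[OF a(1)]] avg_bij[OF bij[OF a(2)]]
      proof (rule avg_abs_diff_le[OF insert.prems(2)])
        fix z assume z: "z \<in> Pi\<^sub>E A B"
        have "z(a := x a) \<in> ?S" using z a insert.hyps by (auto simp: PiE_iff extensional_def)
        then have "\<bar>f (z(a := x a)) - f ((z(a := x a))(a := y a))\<bar> \<le> C"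
          using insert.prems(3) a by blast
        then show "\<bar>(f \<circ> (\<lambda>z. z(a := x a))) z - (f \<circ> (\<lambda>z. z(a := y a))) z\<bar> \<le> C" by simp
      qed
    qed
  qed
  moreover have "real (card A) * (C\<^sup>2 / 8) + C\<^sup>2 / 8 = real (card (insert a A)) * (C\<^sup>2 / 8)"
    using insert.hyps by (simp add: algebra_simps)
  ultimately show ?case by (simp only:)
qed

text \<open>\<open>G\<close>, as a function of the \<open>k\<close>-element subsets of \<open>A\<close>, changes by at most \<open>C\<close> when one element of the
  set is exchanged for another one.\<close>
definition swap_lipschitz :: "'a set \<Rightarrow> nat \<Rightarrow> ('a set \<Rightarrow> real) \<Rightarrow> real \<Rightarrow> bool" where
  "swap_lipschitz A k G C \<longleftrightarrow>
     (\<forall>I\<in>nsets A k. \<forall>J\<in>nsets A k. card (sym_diff I J) = 2 \<longrightarrow> \<bar>G I - G J\<bar> \<le> C)"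

lemma swap_lipschitz_subset:
  "swap_lipschitz A k G C \<Longrightarrow> A' \<subseteq> A \<Longrightarrow> swap_lipschitz A' k G C"
  unfolding swap_lipschitz_def using nsets_mono by blast

lemma swap_lipschitz_insert:
  assumes "swap_lipschitz (insert a A) (Suc k) G C" "a \<notin> A"
  shows "swap_lipschitz A k (G \<circ> insert a) C"
  unfolding swap_lipschitz_def
proof (intro ballI impI)
  fix I J assume IJ: "I \<in> nsets A k" "J \<in> nsets A k" "card (sym_diff I J) = 2"
  then have "a \<notin> I" "a \<notin> J" using assms(2) by (auto simp: nsets_def)
  then have "insert a I \<in> nsets (insert a A) (Suc k)" "insert a J \<in> nsets (insert a A) (Suc k)"
    "sym_diff (insert a I) (insert a J) = sym_diff I J"
    using IJ by (auto simp: nsets_def)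
  with IJ assms(1) show "\<bar>(G \<circ> insert a) I - (G \<circ> insert a) J\<bar> \<le> C"
    by (auto simp: swap_lipschitz_def)
qed

text \<open>Choosing a random \<open>(k+1)\<close>-subset \<open>I\<close> of \<open>A\<close> and replacing a random element of it by \<open>a\<close> gives a
  random \<open>(k+1)\<close>-subset of \<open>insert a A\<close> that contains \<open>a\<close>. So conditioning a random subset on
  whether it contains \<open>a\<close> shifts the mean of \<open>G\<close> by at most one swap.\<close>
lemma avg_nsets_insert:
  assumes fin: "finite A" and a: "a \<notin> A" and k: "Suc k \<le> card A" and C: "0 \<le> C"
    and lip: "swap_lipschitz (insert a A) (Suc k) G C"
  shows "\<bar>avg (nsets A (Suc k)) G - avg (nsets A k) (G \<circ> insert a)\<bar> \<le> C"
proof (rule avg_coupling[where R = "{(I, J). I \<in> nsets A (Suc k) \<and> J \<in> nsets A k \<and> J \<subseteq> I}"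
      and p = "Suc k" and q = "card A - k"])
  show "card {J \<in> nsets A k. (I, J) \<in> {(I, J). I \<in> nsets A (Suc k) \<and> J \<in> nsets A k \<and> J \<subseteq> I}}
      = Suc k" if I: "I \<in> nsets A (Suc k)" for I
  proof -
    have "{J \<in> nsets A k. (I, J) \<in> {(I, J). I \<in> nsets A (Suc k) \<and> J \<in> nsets A k \<and> J \<subseteq> I}}
        = nsets I k"
      using I by (auto simp: nsets_def)
    moreover have "card I = Suc k" using I by (simp add: nsets_def)
    ultimately show ?thesis by simp
  qed
  show "card {I \<in> nsets A (Suc k). (I, J) \<in> {(I, J). I \<in> nsets A (Suc k) \<and> J \<in> nsets A k \<and> J \<subseteq> I}}
      = card A - k" if J: "J \<in> nsets A k" for J
  proof -
    have "{I \<in> nsets A (Suc k). (I, J) \<in> {(I, J). I \<in> nsets A (Suc k) \<and> J \<in> nsets A k \<and> J \<subseteq> I}}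
        = (\<lambda>x. insert x J) ` (A - J)"
    proof (intro equalityI subsetI)
      fix I assume "I \<in> {I \<in> nsets A (Suc k). (I, J) \<in> {(I, J). I \<in> nsets A (Suc k) \<and> J \<in> nsets A k \<and> J \<subseteq> I}}"
      then have I: "I \<subseteq> A" "finite I" "card I = Suc k" "J \<subseteq> I" by (auto simp: nsets_def)
      then have "card (I - J) = 1" using J by (simp add: card_Diff_subset nsets_def)
      then obtain x where "I - J = {x}" by (auto simp: card_1_singleton_iff)
      then have "I = insert x J" "x \<in> A - J" using I by auto
      then show "I \<in> (\<lambda>x. insert x J) ` (A - J)" by auto
    qed (use J in \<open>auto simp: nsets_def\<close>)
    moreover have "inj_on (\<lambda>x. insert x J) (A - J)"
      by (auto simp: inj_on_def)
    ultimately show ?thesis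
      using J fin by (simp add: card_image card_Diff_subset nsets_def)
  qed
  show "\<bar>G I - (G \<circ> insert a) J\<bar> \<le> C"
    if "(I, J) \<in> {(I, J). I \<in> nsets A (Suc k) \<and> J \<in> nsets A k \<and> J \<subseteq> I}" for I J
  proof -
    from that have IJ: "I \<subseteq> A" "finite I" "card I = Suc k" "J \<subseteq> I" "finite J" "card J = k"
      by (auto simp: nsets_def)
    then have "card (I - J) = 1" by (simp add: card_Diff_subset)
    then obtain x where x: "I - J = {x}" by (auto simp: card_1_singleton_iff)
    have "sym_diff I (insert a J) = {x, a}" "a \<noteq> x" using x IJ a by auto
    then have "card (sym_diff I (insert a J)) = 2" by simp
    moreover have "insert a J \<in> nsets (insert a A) (Suc k)" "I \<in> nsets (insert a A) (Suc k)"
      using IJ a by (auto simp: nsets_def card_insert_if)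
    ultimately show ?thesis using lip by (auto simp: swap_lipschitz_def)
  qed
qed (use assms finite_imp_finite_nsets in auto)

lemma nsets_fibre_notin:
  assumes "a \<notin> A"
  shows "{y \<in> nsets (insert a A) k. (a \<in> y) = False} = nsets A k"
  using assms by (auto simp: nsets_def)

lemma nsets_fibre_in:
  assumes "a \<notin> A"
  shows "bij_betw (insert a) (nsets A k) {y \<in> nsets (insert a A) (Suc k). (a \<in> y) = True}"
proof (rule bij_betw_byWitness[where f' = "\<lambda>x. x - {a}"])
  show "(insert a) ` nsets A k \<subseteq> {y \<in> nsets (insert a A) (Suc k). (a \<in> y) = True}"
    using assms by (auto simp: nsets_def card_insert_if subset_iff)
  show "(\<lambda>x. x - {a}) ` {y \<in> nsets (insert a A) (Suc k). (a \<in> y) = True} \<subseteq> nsets A k"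
    using assms by (auto simp: nsets_def)
qed (use assms in \<open>auto simp: nsets_def\<close>)

lemma avg_nsets_fibres_close:
  assumes fin: "finite A" and a: "a \<notin> A" and C: "0 \<le> C"
    and lip: "swap_lipschitz (insert a A) k G C"
    and xy: "x \<in> nsets (insert a A) k" "y \<in> nsets (insert a A) k"
  shows "\<bar>avg {z \<in> nsets (insert a A) k. (a \<in> z) = (a \<in> x)} G
        - avg {z \<in> nsets (insert a A) k. (a \<in> z) = (a \<in> y)} G\<bar> \<le> C"
proof -
  have *: "\<bar>avg {z \<in> nsets (insert a A) k. (a \<in> z) = False} G
        - avg {z \<in> nsets (insert a A) k. (a \<in> z) = True} G\<bar> \<le> C"
    if xy: "x \<in> nsets (insert a A) k" "y \<in> nsets (insert a A) k" "a \<in> x" "a \<notin> y" for x y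
  proof -
    obtain k' where k: "k = Suc k'"
      using xy by (cases k) (auto simp: nsets_def)
    have "y \<subseteq> A" "card y = Suc k'" using xy k by (auto simp: nsets_def)
    then have "Suc k' \<le> card A" using card_mono[OF fin] by metis
    from avg_nsets_insert[OF fin a this C] lip
    show ?thesis unfolding k nsets_fibre_notin[OF a] avg_bij[OF nsets_fibre_in[OF a]] by blast
  qed
  show ?thesis
    using *[of x y] *[of y x] xy C by (cases "a \<in> x"; cases "a \<in> y") (auto simp: abs_minus_commute)
qed

text \<open>Concentration on a slice: reveal for one element of \<open>A\<close> after the other whether the random
  \<open>k\<close>-subset contains it.\<close>
lemma sub_gaussian_nsets:
  assumes "finite A" "0 \<le> C" "swap_lipschitz A k G C"
  shows "sub_gaussian (nsets A k) G (real (card A) * (C\<^sup>2 / 8))"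
  using assms
proof (induction A arbitrary: k G rule: finite_induct)
  case empty
  have "sub_gaussian (nsets {} k) G (0\<^sup>2 / 8)"
    by (rule sub_gaussian_bounded_range) (auto simp: nsets_def)
  then show ?case by simp
next
  case (insert a A)
  let ?S = "nsets (insert a A) k"
  have "sub_gaussian ?S G (real (card A) * (C\<^sup>2 / 8) + C\<^sup>2 / 8)"
  proof (rule sub_gaussian_tower[where \<pi> = "\<lambda>x. a \<in> x"])
    show fin: "finite ?S" using insert by (intro finite_imp_finite_nsets) auto
    show "sub_gaussian {y \<in> ?S. (a \<in> y) = (a \<in> x)} G (real (card A) * (C\<^sup>2 / 8))"
      if x: "x \<in> ?S" for x
    proof (cases "a \<in> x")
      case True
      then obtain k' where k: "k = Suc k'"
        using x by (cases k) (auto simp: nsets_def)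
      have "swap_lipschitz A k' (G \<circ> insert a) C"
        using swap_lipschitz_insert[of a A k' G C] insert.prems(2) insert.hyps(2) k by simp
      from sub_gaussian_bij[OF nsets_fibre_in[OF insert.hyps(2)] insert.IH[OF insert.prems(1) this]]
      show ?thesis unfolding k using True by simp
    next
      case False
      have "swap_lipschitz A k G C"
        using insert.prems(2) swap_lipschitz_subset by blast
      from insert.IH[OF insert.prems(1) this] False show ?thesis
        using nsets_fibre_notin[OF insert.hyps(2), of k] by simp
    qed
    show "sub_gaussian ?S (\<lambda>x. avg {y \<in> ?S. (a \<in> y) = (a \<in> x)} G) (C\<^sup>2 / 8)"
      using avg_nsets_fibres_close[OF insert.hyps insert.prems]
      by (intro sub_gaussian_bounded_range[OF fin]) auto
  qed
  moreover have "real (card A) * (C\<^sup>2 / 8) + C\<^sup>2 / 8 = real (card (insert a A)) * (C\<^sup>2 / 8)"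
    using insert.hyps by (simp add: algebra_simps)
  ultimately show ?case by (simp only:)
qed

text \<open>The next two lemmas compare the mean over a slice with its means over the subsets that avoid,
  respectively contain, a given point.\<close>
lemma avg_nsets_remove:
  assumes fin: "finite A" and a: "a \<notin> A" and C: "0 \<le> C" and k: "k \<le> card A"
    and lip: "swap_lipschitz (insert a A) k G C"
  shows "\<bar>avg (nsets (insert a A) k) G - avg (nsets A k) G\<bar> \<le> C"
proof -
  obtain x where x: "x \<in> nsets A k"
    using k fin by (metis nsets_eq_empty_iff ex_in_conv not_le)
  then have x': "x \<in> nsets (insert a A) k" "a \<notin> x" using a by (auto simp: nsets_def)
  have "\<bar>avg (nsets (insert a A) k) G
        - avg {z \<in> nsets (insert a A) k. (a \<in> z) = (a \<in> x)} G\<bar> \<le> C"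
    using fin C avg_nsets_fibres_close[OF fin a C lip _ x'(1)]
    by (intro avg_fibre_close[OF _ x'(1)] finite_imp_finite_nsets) auto
  then show ?thesis using x' nsets_fibre_notin[OF a, of k] by simp
qed

lemma avg_nsets_contain:
  assumes fin: "finite A" and a: "a \<notin> A" and C: "0 \<le> C" and k: "k \<le> card A"
    and lip: "swap_lipschitz (insert a A) (Suc k) G C"
  shows "\<bar>avg (nsets (insert a A) (Suc k)) G - avg (nsets A k) (G \<circ> insert a)\<bar> \<le> C"
proof -
  obtain x where "x \<in> nsets A k"
    using k fin by (metis nsets_eq_empty_iff ex_in_conv not_le)
  then have x': "insert a x \<in> nsets (insert a A) (Suc k)" "a \<in> insert a x"
    using a by (auto simp: nsets_def card_insert_if)
  have "\<bar>avg (nsets (insert a A) (Suc k)) G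
        - avg {z \<in> nsets (insert a A) (Suc k). (a \<in> z) = (a \<in> insert a x)} G\<bar> \<le> C"
    using fin C avg_nsets_fibres_close[OF fin a C lip _ x'(1)]
    by (intro avg_fibre_close[OF _ x'(1)] finite_imp_finite_nsets) auto
  then show ?thesis using avg_bij[OF nsets_fibre_in[OF a, of k], of G] by simp
qed

section \<open>Ultra-log-concave distributions\<close>

text \<open>A two-crossings criterion for the convex order. If \<open>p\<close> and \<open>b\<close> have the same mass and mean and
  \<open>p \<ge> b\<close> holds exactly on an interval, compare the convex function \<open>\<phi>\<close> with its chord over that
  interval: \<open>p - b\<close> and the difference of \<open>\<phi>\<close> and the chord have opposite signs everywhere, while
  \<open>p - b\<close> annihilates affine functions.\<close>
lemma convex_dominance:
  fixes p b :: "nat \<Rightarrow> real" and \<phi> :: "real \<Rightarrow> real"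
  assumes mass: "(\<Sum>k\<le>N. p k) = (\<Sum>k\<le>N. b k)"
    and mean: "(\<Sum>k\<le>N. real k * p k) = (\<Sum>k\<le>N. real k * b k)"
    and interval: "\<And>i j k. i < j \<Longrightarrow> j < k \<Longrightarrow> k \<le> N \<Longrightarrow> b i \<le> p i \<Longrightarrow> b k \<le> p k \<Longrightarrow> b j \<le> p j"
    and conv: "convex_on UNIV \<phi>"
  shows "(\<Sum>k\<le>N. p k * \<phi> k) \<le> (\<Sum>k\<le>N. b k * \<phi> k)"
proof -
  have three: "(z - x) * \<phi> y \<le> (z - y) * \<phi> x + (y - x) * \<phi> z" if "x \<le> y" "y \<le> z" "x < z" for x y z
  proof -
    have "\<phi> y \<le> (\<phi> z - \<phi> x) / (z - x) * (y - x) + \<phi> x"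
      using that by (intro convex_onD_Icc' convex_on_subset[OF conv]) auto
    then have "(z - x) * \<phi> y \<le> (z - x) * ((\<phi> z - \<phi> x) / (z - x) * (y - x) + \<phi> x)"
      using that by (intro mult_left_mono) auto
    also have "\<dots> = (z - y) * \<phi> x + (y - x) * \<phi> z"
      using that by (simp add: field_simps)
    finally show ?thesis .
  qed
  define A where "A = {k. k \<le> N \<and> b k \<le> p k}"
  have "finite A" by (simp add: A_def)
  have "A \<noteq> {}"
  proof
    assume "A = {}"
    then have "p k < b k" if "k \<le> N" for k
      using that by (force simp: A_def)
    then have "(\<Sum>k\<le>N. p k) < (\<Sum>k\<le>N. b k)"
      by (intro sum_strict_mono) auto
    with mass show False by simp
  qed
  define i k where "i = Min A" and "k = Max A"
  have ik: "i \<in> A" "k \<in> A" "\<And>j. j \<in> A \<Longrightarrow> i \<le> j \<and> j \<le> k"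
    unfolding i_def k_def using \<open>finite A\<close> \<open>A \<noteq> {}\<close> by auto
  have A: "j \<in> A" if "i \<le> j" "j \<le> k" for j
    using interval[of i j k] ik that by (cases "j = i \<or> j = k") (auto simp: A_def)
  \<comment> \<open>If the interval \<open>{i..k}\<close> is a single point, the chord over \<open>{i..i+1}\<close> serves as well.\<close>
  define m where "m = max k (Suc i)"
  have im: "i < m" by (simp add: m_def)
  define c d where "c = (real m * \<phi> i - real i * \<phi> m) / (real m - real i)"
    and "d = (\<phi> m - \<phi> i) / (real m - real i)"
  have line: "(real m - real i) * (c + d * x) = (real m - x) * \<phi> i + (x - real i) * \<phi> m" for x
  proof -
    have "(real m - real i) * c = real m * \<phi> i - real i * \<phi> m"
      "(real m - real i) * d = \<phi> m - \<phi> i"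
      using im by (simp_all add: c_def d_def)
    then show ?thesis by algebra
  qed
  have pos: "real m - real i > 0" using im by simp
  have neg: "(p j - b j) * (\<phi> j - (c + d * real j)) \<le> 0" if "j \<le> N" for j
  proof (cases "i \<le> j \<and> j \<le> k")
    case True
    then have "j \<le> m" by (auto simp: m_def)
    with True three[of "real i" "real j" "real m"] im
    have "(real m - real i) * \<phi> j \<le> (real m - real i) * (c + d * real j)"
      unfolding line by auto
    then have "\<phi> j \<le> c + d * real j" using pos by simp
    moreover have "b j \<le> p j" using A True by (auto simp: A_def)
    ultimately show ?thesis by (intro mult_nonneg_nonpos) auto
  next
    case False
    then have "j < i \<or> m \<le> j" using ik(3)[OF ik(1)] by (auto simp: m_def)
    then have "(real m - real i) * (c + d * real j) \<le> (real m - real i) * \<phi> j"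
      using three[of "real j" "real i" "real m"] three[of "real i" "real m" "real j"] im
      unfolding line by (auto simp: algebra_simps)
    then have "c + d * real j \<le> \<phi> j" using pos by simp
    moreover have "p j \<le> b j" using ik(3)[of j] False that by (force simp: A_def)
    ultimately show ?thesis by (intro mult_nonpos_nonneg) auto
  qed
  have "(\<Sum>j\<le>N. p j * \<phi> j) - (\<Sum>j\<le>N. b j * \<phi> j) - c * ((\<Sum>j\<le>N. p j) - (\<Sum>j\<le>N. b j))
      - d * ((\<Sum>j\<le>N. real j * p j) - (\<Sum>j\<le>N. real j * b j))
      = (\<Sum>j\<le>N. (p j - b j) * (\<phi> j - (c + d * real j)))"
    by (simp add: sum_subtractf[symmetric] sum_distrib_left algebra_simps)
  also have "\<dots> \<le> 0"
    by (intro sum_nonpos neg) auto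
  finally show ?thesis using mass mean by simp
qed

lemma log_concave_superlevel_interval:
  fixes r :: "nat \<Rightarrow> real"
  assumes pos: "\<And>k. k \<le> N \<Longrightarrow> 0 < r k"
    and lc: "\<And>k. k + 2 \<le> N \<Longrightarrow> r k * r (k + 2) \<le> (r (k + 1))\<^sup>2"
    and ijk: "i < j" "j < k" "k \<le> N" "c \<le> r i" "c \<le> r k"
  shows "c \<le> r j"
proof (rule ccontr)
  assume "\<not> c \<le> r j"
  then have "r j < r i" "r j < r k" using ijk by auto
  have "\<exists>s. i \<le> s \<and> s < j \<and> r (s + 1) < r s"
  proof (rule ccontr)
    assume "\<not> ?thesis"
    then have up: "r s \<le> r (s + 1)" if "i \<le> s" "s < j" for s using that by (auto simp: not_less)
    have "r i \<le> r t" if "i \<le> t" "t \<le> j" for t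
      using that
    proof (induction t rule: dec_induct)
      case (step t)
      then show ?case using up[of t] by auto
    qed simp
    from this[of j] show False using \<open>r j < r i\<close> \<open>i < j\<close> by simp
  qed
  then obtain s where s: "i \<le> s" "s < j" "r (s + 1) < r s" by blast
  have dec: "r (t + 1) < r t" if "s \<le> t" "t < N" for t
    using that
  proof (induction t rule: dec_induct)
    case (step t)
    then have IH: "r (t + 1) < r t" by simp
    have "r t * r (t + 2) \<le> r (t + 1) * r (t + 1)"
      using lc[of t] step by (simp add: power2_eq_square)
    also have "\<dots> < r t * r (t + 1)"
      using IH pos[of "t + 1"] step by simp
    finally show ?case using pos[of t] step by simp
  qed (use s in auto)
  have "r t \<le> r j" if "j \<le> t" "t \<le> N" for t
    using that
  proof (induction t rule: dec_induct)
    case (step t)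
    then show ?case using dec[of t] s by auto
  qed simp
  from this[of k] show False using \<open>r j < r k\<close> ijk by simp
qed

lemma bernoulli_mgf:
  fixes \<theta> l :: real
  assumes "0 \<le> \<theta>" "\<theta> \<le> 1"
  shows "\<theta> * exp (l * (1 - \<theta>)) + (1 - \<theta>) * exp (- (l * \<theta>)) \<le> exp (l\<^sup>2 / 8)"
proof -
  have "measure_pmf.expectation (bernoulli_pmf \<theta>) (\<lambda>x. exp (l * (of_bool x - \<theta>)))
      \<le> exp (l\<^sup>2 * (1 - 0)\<^sup>2 / 8)"
    by (rule Hoeffding_pmf) (use assms in auto)
  then show ?thesis using assms by (simp add: mult.commute)
qed

text \<open>A distribution \<open>w\<close> on \<open>{0..N}\<close> whose quotient by the binomial coefficients is log-concave is
  dominated in the convex order by the binomial distribution with the same mean, which is a sum of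
  \<open>N\<close> independent Bernoulli variables.\<close>
lemma ultra_log_concave_mgf:
  fixes w q :: "nat \<Rightarrow> real"
  assumes N: "1 \<le> N"
    and w: "\<And>k. k \<le> N \<Longrightarrow> w k = real (N choose k) * q k"
    and pos: "\<And>k. k \<le> N \<Longrightarrow> 0 < q k"
    and lc: "\<And>k. k + 2 \<le> N \<Longrightarrow> q k * q (k + 2) \<le> (q (k + 1))\<^sup>2"
    and \<mu>: "\<mu> = (\<Sum>k\<le>N. w k * real k) / (\<Sum>k\<le>N. w k)"
  shows "(\<Sum>k\<le>N. w k * exp (l * (real k - \<mu>))) \<le> (\<Sum>k\<le>N. w k) * exp (l\<^sup>2 * (real N / 8))"
proof -
  define W where "W = (\<Sum>k\<le>N. w k)"
  have wpos: "0 < w k" if "k \<le> N" for k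
    using w[OF that] pos[OF that] that by simp
  have wnonneg: "0 \<le> w k" if "k \<le> N" for k
    using wpos[OF that] by simp
  have W: "0 < W" unfolding W_def using wpos by (intro sum_pos) auto
  \<comment> \<open>The success probability that matches the means; both endpoints have positive weight, so
    \<open>0 < \<theta> < 1\<close>.\<close>
  define \<theta> where "\<theta> = \<mu> / real N"
  have W\<mu>: "(\<Sum>k\<le>N. real k * w k) = W * \<mu>"
    using W by (simp add: \<mu> W_def[symmetric] mult.commute)
  have "0 < (\<Sum>k\<le>N. real k * w k)"
    by (rule sum_pos2[where i = 1]) (use wpos[of 1] wnonneg N in auto)
  then have \<mu>0: "0 < \<mu>" using W unfolding W\<mu> by (simp add: zero_less_mult_iff)
  have "0 < (\<Sum>k\<le>N. (real N - real k) * w k)"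
    by (rule sum_pos2[where i = 0]) (use wpos[of 0] wnonneg N in auto)
  also have "\<dots> = W * (real N - \<mu>)"
    using W\<mu> by (simp add: W_def sum_subtractf left_diff_distrib sum_distrib_left algebra_simps)
  finally have \<mu>N: "\<mu> < real N" using W by (simp add: zero_less_mult_iff)
  have \<theta>: "0 < \<theta>" "\<theta> < 1" "real N * \<theta> = \<mu>"
    using \<mu>0 \<mu>N N by (auto simp: \<theta>_def)
  define b where "b k = W * (real (N choose k) * \<theta> ^ k * (1 - \<theta>) ^ (N - k))" for k
  have mass: "(\<Sum>k\<le>N. b k) = W"
    using binomial_ring[of \<theta> "1 - \<theta>" N] by (simp add: b_def sum_distrib_left[symmetric])
  have mean: "(\<Sum>k\<le>N. real k * b k) = W * \<mu>"
  proof -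
    have "(\<Sum>k\<le>N. real k * b k)
        = W * \<theta> * (\<Sum>k\<le>N. real k * real (N choose k) * \<theta> ^ (k - 1) * (1 - \<theta>) ^ (N - k))"
      unfolding sum_distrib_left
    proof (rule sum.cong[OF refl])
      fix k show "real k * b k = W * \<theta> * (real k * real (N choose k) * \<theta> ^ (k - 1) * (1 - \<theta>) ^ (N - k))"
        by (cases k) (simp_all add: b_def)
    qed
    also have "\<dots> = W * \<mu>"
      using binomial_deriv1[of N \<theta> "1 - \<theta>"] \<theta>(3) by (simp add: mult.commute)
    finally show ?thesis .
  qed
  define r where "r k = q k / (W * (\<theta> ^ k * (1 - \<theta>) ^ (N - k)))" for k
  have bpos: "0 < b k" if "k \<le> N" for k
    using W \<theta> that by (simp add: b_def)
  have wb: "w k = r k * b k" if "k \<le> N" for k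
    using W \<theta> that by (simp add: b_def r_def w)
  have "(\<Sum>k\<le>N. w k * exp (l * (real k - \<mu>))) \<le> (\<Sum>k\<le>N. b k * exp (l * (real k - \<mu>)))"
  proof (rule convex_dominance)
    show "(\<Sum>k\<le>N. w k) = (\<Sum>k\<le>N. b k)" using mass by (simp add: W_def)
    show "(\<Sum>k\<le>N. real k * w k) = (\<Sum>k\<le>N. real k * b k)" using mean W\<mu> by simp
    show "convex_on UNIV (\<lambda>x. exp (l * (x - \<mu>)))"
      by (rule convex_on_realI[where f' = "\<lambda>x. l * exp (l * (x - \<mu>))"])
        (auto intro!: derivative_eq_intros simp: mult_le_cancel_left)
    fix i j k assume ijk: "i < j" "j < k" "k \<le> N" "b i \<le> w i" "b k \<le> w k"
    have "1 \<le> r j"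
    proof (rule log_concave_superlevel_interval[of N r i j k])
      show "0 < r k" if "k \<le> N" for k
        using pos[OF that] W \<theta> by (simp add: r_def)
      show "r k * r (k + 2) \<le> (r (k + 1))\<^sup>2" if k: "k + 2 \<le> N" for k
      proof -
        obtain e where e: "N = k + 2 + e" using k le_Suc_ex by blast
        have "r k * r (k + 2) = q k * q (k + 2) / (W * (\<theta> ^ (k+1) * (1 - \<theta>) ^ (e+1)))\<^sup>2"
          by (simp add: r_def e power_add power2_eq_square numeral_2_eq_2 mult_ac)
        also have "\<dots> \<le> (q (k + 1))\<^sup>2 / (W * (\<theta> ^ (k+1) * (1 - \<theta>) ^ (e+1)))\<^sup>2"
          using lc[OF k] by (intro divide_right_mono) auto
        also have "\<dots> = (r (k + 1))\<^sup>2"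
          by (simp add: r_def e power_divide)
        finally show ?thesis .
      qed
      show "1 \<le> r i" "1 \<le> r k"
        using ijk wb[of i] wb[of k] bpos[of i] bpos[of k] by auto
    qed (use ijk in auto)
    then show "b j \<le> w j"
      using ijk wb[of j] bpos[of j] by auto
  qed
  also have "\<dots> = W * (\<theta> * exp (l * (1 - \<theta>)) + (1 - \<theta>) * exp (- (l * \<theta>))) ^ N"
    unfolding binomial_ring sum_distrib_left
  proof (rule sum.cong[OF refl])
    fix k assume "k \<in> {..N}"
    then obtain e where e: "N = k + e" using le_Suc_ex by auto
    have "exp (l * (real k - \<mu>)) = exp (l * (1 - \<theta>)) ^ k * exp (- (l * \<theta>)) ^ e"
      unfolding exp_of_nat_mult[symmetric] \<theta>(3)[symmetric] e by (simp add: mult_exp_exp algebra_simps)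
    then show "b k * exp (l * (real k - \<mu>)) = W * (of_nat (N choose k)
        * (\<theta> * exp (l * (1 - \<theta>))) ^ k * ((1 - \<theta>) * exp (- (l * \<theta>))) ^ (N - k))"
      by (simp add: b_def e power_mult_distrib mult_ac)
  qed
  also have "\<dots> \<le> W * exp (l\<^sup>2 / 8) ^ N"
    using W \<theta> by (intro mult_left_mono power_mono bernoulli_mgf add_nonneg_nonneg) auto
  also have "\<dots> = W * exp (l\<^sup>2 * (real N / 8))"
    by (simp add: exp_of_nat_mult[symmetric] mult_ac)
  finally show ?thesis by (simp add: W_def)
qed

lemma avg_by_level:
  fixes \<pi> :: "'a \<Rightarrow> nat"
  assumes "finite S" "\<And>x. x \<in> S \<Longrightarrow> \<pi> x \<le> N"
  shows "avg S (\<lambda>x. h (\<pi> x)) = (\<Sum>k\<le>N. real (card {x \<in> S. \<pi> x = k}) * h k)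
      / (\<Sum>k\<le>N. real (card {x \<in> S. \<pi> x = k}))"
proof -
  have *: "(\<Sum>x\<in>S. g (\<pi> x)) = (\<Sum>k\<le>N. real (card {x \<in> S. \<pi> x = k}) * g k)" for g :: "nat \<Rightarrow> real"
  proof -
    have "(\<Sum>x\<in>S. g (\<pi> x)) = (\<Sum>k\<le>N. \<Sum>x\<in>{x \<in> S. \<pi> x = k}. g (\<pi> x))"
      by (rule sum.group[symmetric]) (use assms in auto)
    also have "\<dots> = (\<Sum>k\<le>N. real (card {x \<in> S. \<pi> x = k}) * g k)"
      by (intro sum.cong) auto
    finally show ?thesis .
  qed
  show ?thesis unfolding avg_def using *[of h] *[of "\<lambda>_. 1"] by simp
qed

lemma sub_gaussian_ultra_log_concave:
  fixes \<pi> :: "'a \<Rightarrow> nat"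
  assumes fin: "finite S" and le: "\<And>x. x \<in> S \<Longrightarrow> \<pi> x \<le> N" and N: "1 \<le> N"
    and w: "\<And>k. k \<le> N \<Longrightarrow> real (card {x \<in> S. \<pi> x = k}) = real (N choose k) * q k"
    and pos: "\<And>k. k \<le> N \<Longrightarrow> 0 < q k"
    and lc: "\<And>k. k + 2 \<le> N \<Longrightarrow> q k * q (k + 2) \<le> (q (k + 1))\<^sup>2"
  shows "sub_gaussian S (\<lambda>x. real (\<pi> x)) (real N / 8)"
  unfolding sub_gaussian_def
proof
  fix l :: real
  let ?w = "\<lambda>k. real (card {x \<in> S. \<pi> x = k})"
  have "0 < ?w k" if "k \<le> N" for k
    unfolding w[OF that] using pos[OF that] that by simp
  then have pos_sum: "0 < (\<Sum>k\<le>N. ?w k)" by (intro sum_pos) auto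
  define \<mu> where "\<mu> = avg S (\<lambda>x. real (\<pi> x))"
  have \<mu>: "\<mu> = (\<Sum>k\<le>N. ?w k * real k) / (\<Sum>k\<le>N. ?w k)"
    unfolding \<mu>_def by (rule avg_by_level[OF fin le, where h = real])
  have "avg S (\<lambda>x. exp (l * (real (\<pi> x) - \<mu>)))
      = (\<Sum>k\<le>N. ?w k * exp (l * (real k - \<mu>))) / (\<Sum>k\<le>N. ?w k)"
    by (rule avg_by_level[OF fin le, where h = "\<lambda>k. exp (l * (real k - \<mu>))"])
  also have "\<dots> \<le> exp (l\<^sup>2 * (real N / 8))"
    using ultra_log_concave_mgf[of N ?w q, OF N w pos lc \<mu>, of l] pos_sum
    by (simp add: pos_divide_le_eq mult.commute)
  finally show "avg S (\<lambda>x. exp (l * (real (\<pi> x) - avg S (\<lambda>x. real (\<pi> x))))) \<le> exp (l\<^sup>2 * (real N / 8))"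
    by (simp add: \<mu>_def)
qed

section \<open>The shift as a bijection onto sets without neighbours\<close>

text \<open>The shift applied by \<open>tau I\<close> to the element \<open>x\<close>, expressed by its rank in \<open>I\<close>.\<close>
definition shift_up :: "nat set \<Rightarrow> nat \<Rightarrow> nat" where
  "shift_up I x = x + card {y \<in> I. y < x}"

text \<open>The inverse operation, for elements \<open>x\<close> of a set \<open>S\<close> of positive integers without neighbours;
  the subtraction does not truncate there.\<close>
definition shift_down :: "nat set \<Rightarrow> nat \<Rightarrow> nat" where
  "shift_down S x = x - card {y \<in> S. y < x}"

text \<open>Sets without two consecutive elements.\<close>
definition nonadjacent :: "nat set \<Rightarrow> bool" where
  "nonadjacent S \<longleftrightarrow> (\<forall>i\<in>S. Suc i \<notin> S)"

lemma tau_eq_shift_up: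
  assumes "finite I"
  shows "tau I = shift_up I ` I"
proof -
  let ?xs = "sorted_list_of_set I"
  have sort: "sorted_wrt (<) ?xs" "set ?xs = I" "length ?xs = card I" "distinct ?xs"
    using assms by auto
  have "shift_up I (?xs ! j) = ?xs ! j + j" if j: "j < card I" for j
  proof -
    have "{y \<in> I. y < ?xs ! j} = (!) ?xs ` {..<j}"
    proof (intro equalityI subsetI)
      fix y assume "y \<in> {y \<in> I. y < ?xs ! j}"
      then have "y \<in> set ?xs" "y < ?xs ! j" using sort(2) by auto
      then obtain i where i: "i < card I" "y = ?xs ! i"
        using sort(3) by (metis in_set_conv_nth)
      have "i < j"
      proof (rule ccontr)
        assume "\<not> i < j"
        then have "?xs ! j \<le> ?xs ! i"
          using sorted_wrt_nth_less[OF sort(1), of j i] sort(3) i by (cases "i = j") auto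
        then show False using i \<open>y < ?xs ! j\<close> by simp
      qed
      then show "y \<in> (!) ?xs ` {..<j}" using i by auto
    next
      fix y assume "y \<in> (!) ?xs ` {..<j}"
      then obtain i where i: "i < j" "y = ?xs ! i" by auto
      then show "y \<in> {y \<in> I. y < ?xs ! j}"
        using sorted_wrt_nth_less[OF sort(1), of i j] sort(2,3) j nth_mem[of i ?xs] by auto
    qed
    moreover have "inj_on ((!) ?xs) {..<j}"
      using sort j by (intro inj_on_nth) auto
    ultimately show ?thesis by (simp add: shift_up_def card_image)
  qed
  then have "tau I = (\<lambda>j. shift_up I (?xs ! j)) ` {..<card I}"
    by (auto simp: tau_def)
  also have "\<dots> = shift_up I ` ((!) ?xs ` {..<card I})"
    by (simp add: image_image)
  also have "(!) ?xs ` {..<card I} = I"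
    using sort(2,3) by (metis nth_image take_all order_refl lessThan_atLeast0)
  finally show ?thesis .
qed

lemma shift_up_gap:
  assumes "finite I" "x \<in> I" "x < y"
  shows "shift_up I x + 2 \<le> shift_up I y"
proof -
  \<comment> \<open>The rank of \<open>y\<close> exceeds that of \<open>x\<close>, which adds one to the gap \<open>y - x \<ge> 1\<close>.\<close>
  have "card (insert x {z \<in> I. z < x}) \<le> card {z \<in> I. z < y}"
    using assms by (intro card_mono) auto
  then show ?thesis using assms by (simp add: shift_up_def)
qed

lemma shift_up_less_iff:
  assumes "finite I" "x \<in> I" "y \<in> I"
  shows "shift_up I x < shift_up I y \<longleftrightarrow> x < y"
  using shift_up_gap[OF assms(1,2), of y] shift_up_gap[OF assms(1,3), of x]
  by (cases x y rule: linorder_cases) auto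

lemma inj_on_shift_up: "finite I \<Longrightarrow> inj_on (shift_up I) I"
  by (intro inj_onI) (metis less_irrefl linorder_neqE_nat shift_up_less_iff)

lemma shift_down_tau:
  assumes fin: "finite I" and x: "x \<in> I"
  shows "shift_down (tau I) (shift_up I x) = x"
proof -
  have "{z \<in> tau I. z < shift_up I x} = shift_up I ` {z \<in> I. z < x}"
    using shift_up_less_iff[OF fin _ x] by (auto simp: tau_eq_shift_up[OF fin])
  moreover have "inj_on (shift_up I) {z \<in> I. z < x}"
    using inj_on_shift_up[OF fin] by (rule inj_on_subset) auto
  ultimately have "card {z \<in> tau I. z < shift_up I x} = card {z \<in> I. z < x}"
    by (simp add: card_image)
  then show ?thesis by (simp add: shift_down_def shift_up_def)
qed

lemma shift_down_image_tau: "finite I \<Longrightarrow> shift_down (tau I) ` tau I = I"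
  by (subst (2) tau_eq_shift_up) (auto simp: shift_down_tau image_image)

lemma card_tau: "finite I \<Longrightarrow> card (tau I) = card I"
  by (simp add: tau_eq_shift_up card_image inj_on_shift_up)

lemma nonadjacent_tau:
  assumes "finite I"
  shows "nonadjacent (tau I)"
proof -
  have "shift_up I y \<noteq> Suc (shift_up I x)" if "x \<in> I" "y \<in> I" for x y
    using shift_up_gap[OF assms that(1), of y] shift_up_gap[OF assms that(2), of x]
    by (cases x y rule: linorder_cases) auto
  then show ?thesis
    unfolding nonadjacent_def tau_eq_shift_up[OF assms] by fastforce
qed

lemma shift_down_bounds:
  assumes S: "S \<subseteq> {1..m}" and x: "x \<in> S"
  shows "card {y \<in> S. y < x} < x" and "shift_down S x + card S \<le> m + 1"
proof -
  have fin: "finite S" using S finite_subset by blast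
  have "card {y \<in> S. y < x} \<le> card {1..<x}"
    using S by (intro card_mono) auto
  then show less: "card {y \<in> S. y < x} < x" using S x by force
  have "S \<subseteq> {y \<in> S. y < x} \<union> {x..m}" using S by auto
  then have "card S \<le> card ({y \<in> S. y < x} \<union> {x..m})"
    using fin by (intro card_mono) auto
  also have "\<dots> \<le> card {y \<in> S. y < x} + card {x..m}" by (rule card_Un_le)
  finally show "shift_down S x + card S \<le> m + 1"
    using less S x by (auto simp: shift_down_def)
qed

lemma shift_down_less:
  assumes S: "S \<subseteq> {1..m}" "nonadjacent S" and xy: "x \<in> S" "y \<in> S" "x < y"
  shows "shift_down S x < shift_down S y"
proof -
  have fin: "finite S" using S finite_subset by blast
  have "y \<noteq> Suc x" using S(2) xy by (auto simp: nonadjacent_def)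
  \<comment> \<open>So at least one point between \<open>x\<close> and \<open>y\<close> is missing from \<open>S\<close>.\<close>
  then have "Suc x \<in> {x..<y}" using xy by auto
  have "card {z \<in> S. z < y} \<le> card ({z \<in> S. z < x} \<union> ({x..<y} - {Suc x}))"
    using fin S(2) xy by (intro card_mono) (auto simp: nonadjacent_def)
  also have "\<dots> \<le> card {z \<in> S. z < x} + card ({x..<y} - {Suc x})" by (rule card_Un_le)
  also have "card ({x..<y} - {Suc x}) = y - x - 1"
    using \<open>Suc x \<in> {x..<y}\<close> by simp
  finally show ?thesis
    using shift_down_bounds(1)[OF S(1) xy(1)] xy(3) by (simp add: shift_down_def)
qed

lemma tau_shift_down:
  assumes S: "S \<subseteq> {1..m}" "nonadjacent S"
  shows "card (shift_down S ` S) = card S" and "tau (shift_down S ` S) = S"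
proof -
  have fin: "finite S" using S finite_subset by blast
  have less: "shift_down S x < shift_down S y \<longleftrightarrow> x < y" if "x \<in> S" "y \<in> S" for x y
    using shift_down_less[OF S, of x y] shift_down_less[OF S, of y x] that
    by (cases x y rule: linorder_cases) auto
  then have inj: "inj_on (shift_down S) S"
    by (intro inj_onI) (metis less_irrefl linorder_neqE_nat)
  then show "card (shift_down S ` S) = card S" by (rule card_image)
  have "shift_up (shift_down S ` S) (shift_down S x) = x" if x: "x \<in> S" for x
  proof -
    have "{y \<in> shift_down S ` S. y < shift_down S x} = shift_down S ` {y \<in> S. y < x}"
      using less x by auto
    then have "card {y \<in> shift_down S ` S. y < shift_down S x} = card {y \<in> S. y < x}"
      using inj by (simp add: card_image inj_on_subset)
    then show ?thesis
      using shift_down_bounds(1)[OF S(1) x] by (simp add: shift_up_def shift_down_def)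
  qed
  then show "tau (shift_down S ` S) = S"
    using fin by (simp add: tau_eq_shift_up image_image)
qed

lemma bij_betw_tau:
  assumes "k \<le> n"
  shows "bij_betw tau (nsets {1..n-k} k) {S \<in> nsets {1..n-1} k. nonadjacent S}"
proof (rule bij_betw_byWitness[where f' = "\<lambda>S. shift_down S ` S"])
  show "\<forall>I\<in>nsets {1..n-k} k. shift_down (tau I) ` tau I = I"
    by (auto simp: nsets_def shift_down_image_tau)
  show "\<forall>S\<in>{S \<in> nsets {1..n-1} k. nonadjacent S}. tau (shift_down S ` S) = S"
    by (auto simp: nsets_def intro!: tau_shift_down(2))
  show "tau ` nsets {1..n-k} k \<subseteq> {S \<in> nsets {1..n-1} k. nonadjacent S}"
  proof clarify
    fix I assume "I \<in> nsets {1..n-k} k"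
    then have I: "I \<subseteq> {1..n-k}" "finite I" "card I = k" by (auto simp: nsets_def)
    have "shift_up I x \<in> {1..n-1}" if x: "x \<in> I" for x
    proof -
      have "card {y \<in> I. y < x} < card I"
        using I x by (intro psubset_card_mono) auto
      moreover have "1 \<le> x" "x \<le> n - k" using I x by auto
      ultimately show ?thesis using I assms by (auto simp: shift_up_def)
    qed
    then have "tau I \<subseteq> {1..n-1}" by (auto simp: tau_eq_shift_up[OF I(2)])
    then show "tau I \<in> nsets {1..n-1} k \<and> nonadjacent (tau I)"
      using I by (auto simp: nsets_def card_tau nonadjacent_tau finite_subset)
  qed
  show "(\<lambda>S. shift_down S ` S) ` {S \<in> nsets {1..n-1} k. nonadjacent S} \<subseteq> nsets {1..n-k} k"
  proof clarify
    fix S assume "S \<in> nsets {1..n-1} k" "nonadjacent S"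
    then have S: "S \<subseteq> {1..n-1}" "finite S" "card S = k" "nonadjacent S" by (auto simp: nsets_def)
    have "shift_down S x \<in> {1..n-k}" if x: "x \<in> S" for x
      using shift_down_bounds[OF S(1) x] S(3) x S(1) by (auto simp: shift_down_def)
    then show "shift_down S ` S \<in> nsets {1..n-k} k"
      using S tau_shift_down(1)[OF S(1,4)] by (auto simp: nsets_def)
  qed
qed

lemma tau_insert_top:
  assumes "finite I" "\<And>x. x \<in> I \<Longrightarrow> x < m"
  shows "tau (insert m I) = insert (m + card I) (tau I)"
proof -
  have "shift_up (insert m I) x = shift_up I x" if "x \<in> I" for x
  proof -
    have "{y. (y = m \<or> y \<in> I) \<and> y < x} = {y \<in> I. y < x}" using assms(2)[OF that] by auto
    then show ?thesis by (simp add: shift_up_def)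
  qed
  moreover have "{y \<in> insert m I. y < m} = I" using assms(2) by auto
  ultimately show ?thesis
    using assms(1) by (simp add: tau_eq_shift_up shift_up_def[of _ m])
qed

section \<open>Sparse vectors and their supports\<close>

text \<open>The support of a vector with index set \<open>{1..n-1}\<close>.\<close>
definition supp :: "nat \<Rightarrow> (nat \<Rightarrow> nat) \<Rightarrow> nat set" where
  "supp n x = {i \<in> {1..n-1}. x i \<noteq> 0}"

lemma finite_supp [simp]: "finite (supp n x)"
  by (simp add: supp_def)

lemma supp_box_eq_PiE:
  "supp_box n d I = Pi\<^sub>E {1..n-1} (\<lambda>i. if i \<in> I then {1..d} else {0})"
proof -
  have "v \<in> (if i \<in> I then {1..d} else {0})
      \<longleftrightarrow> v \<in> {0..d} \<and> (if i \<in> I then v \<in> {1..d} else v = 0)" for v i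
    by auto
  then show ?thesis
    unfolding supp_box_def cube_def by (intro set_eqI) (simp only: PiE_iff mem_Collect_eq, blast)
qed

lemma finite_supp_box: "finite (supp_box n d I)"
  unfolding supp_box_def cube_def by (auto intro!: finite_PiE)

lemma supp_box_nonempty:
  assumes "1 \<le> d"
  shows "supp_box n d I \<noteq> {}"
  unfolding supp_box_eq_PiE using assms by (auto simp: PiE_eq_empty_iff)

lemma card_supp_box:
  assumes "I \<subseteq> {1..n-1}"
  shows "card (supp_box n d I) = d ^ card I"
proof -
  have "card (supp_box n d I) = (\<Prod>i\<in>{1..n-1}. if i \<in> I then d else 1)"
    unfolding supp_box_eq_PiE by (subst card_PiE) (auto intro!: prod.cong)
  also have "\<dots> = (\<Prod>i\<in>{1..n-1} \<inter> {i. i \<in> I}. d)"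
    by (simp add: prod.If_cases)
  also have "{1..n-1} \<inter> {i. i \<in> I} = I" using assms by auto
  finally show ?thesis by simp
qed

lemma SB_altdef: "SB n d = {x \<in> cube n d. nonadjacent (supp n x)}"
proof -
  have "(\<forall>i\<in>{1..n-2}. x i * x (i + 1) = 0) \<longleftrightarrow> nonadjacent (supp n x)" for x :: "nat \<Rightarrow> nat"
  proof
    assume L: "\<forall>i\<in>{1..n-2}. x i * x (i + 1) = 0"
    show "nonadjacent (supp n x)"
      unfolding nonadjacent_def
    proof (intro ballI notI)
      fix i assume "i \<in> supp n x" "Suc i \<in> supp n x"
      then have i: "1 \<le> i" "Suc i \<le> n - 1" "x i \<noteq> 0" "x (Suc i) \<noteq> 0" by (auto simp: supp_def)
      then have "i \<in> {1..n-2}" by simp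
      then show False using L[rule_format, of i] i by simp
    qed
  next
    assume R: "nonadjacent (supp n x)"
    show "\<forall>i\<in>{1..n-2}. x i * x (i + 1) = 0"
    proof
      fix i assume "i \<in> {1..n-2}"
      then have "i \<in> {1..n-1}" "Suc i \<in> {1..n-1}" by auto
      then show "x i * x (i + 1) = 0" using R by (force simp: nonadjacent_def supp_def)
    qed
  qed
  then show ?thesis by (auto simp: SB_def)
qed

lemma finite_SB: "finite (SB n d)"
  unfolding SB_def cube_def by (auto intro!: finite_PiE)

lemma SB_supp_fibre:
  assumes "T \<subseteq> {1..n-1}" "nonadjacent T"
  shows "{x \<in> SB n d. supp n x = T} = supp_box n d T"
proof -
  have "supp n x = T \<longleftrightarrow> (\<forall>i\<in>{1..n-1}. if i \<in> T then x i \<in> {1..d} else x i = 0)"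
    if x: "x \<in> cube n d" for x
  proof -
    have "(x i \<noteq> 0 \<longleftrightarrow> i \<in> T) \<longleftrightarrow> (if i \<in> T then x i \<in> {1..d} else x i = 0)"
      if "i \<in> {1..n-1}" for i
    proof -
      have "x i \<in> {0..d}" using x that by (auto simp: cube_def)
      then show ?thesis by auto
    qed
    moreover have "supp n x = T \<longleftrightarrow> (\<forall>i\<in>{1..n-1}. x i \<noteq> 0 \<longleftrightarrow> i \<in> T)"
      using assms(1) by (auto simp: supp_def)
    ultimately show ?thesis by blast
  qed
  then have "x \<in> cube n d \<and> supp n x = T \<longleftrightarrow> x \<in> supp_box n d T" for x
    unfolding supp_box_def by blast
  moreover have "{x \<in> SB n d. supp n x = T} = {x. x \<in> cube n d \<and> supp n x = T}"
    using assms(2) by (auto simp: SB_altdef)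
  ultimately show ?thesis by simp
qed

text \<open>Coupling: setting the coordinate \<open>a\<close> of a uniform point of the box of \<open>insert a I\<close> to \<open>0\<close> gives a
  uniform point of the box of \<open>I\<close>.\<close>
lemma avg_supp_box_insert:
  assumes d: "1 \<le> d" and a: "a \<in> {1..n-1}" "a \<notin> I" and C: "0 \<le> C"
    and lip: "\<And>i x y. i \<in> {1..n-1} \<Longrightarrow> x \<in> cube n d \<Longrightarrow> y \<in> {0..d} \<Longrightarrow> \<bar>f x - f (x(i := y))\<bar> \<le> C"
  shows "\<bar>avg (supp_box n d (insert a I)) f - avg (supp_box n d I) f\<bar> \<le> C"
proof (rule avg_coupling[where p = 1 and q = d and
      R = "{(x, y). x \<in> supp_box n d (insert a I) \<and> y \<in> supp_box n d I \<and> y = x(a := 0)}"])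
  have down: "x(a := 0) \<in> supp_box n d I" if "x \<in> supp_box n d (insert a I)" for x
    using that a by (auto simp: supp_box_def cube_def PiE_iff extensional_def split: if_splits)
  show "card {y \<in> supp_box n d I.
      (x, y) \<in> {(x, y). x \<in> supp_box n d (insert a I) \<and> y \<in> supp_box n d I \<and> y = x(a := 0)}} = 1"
    if x: "x \<in> supp_box n d (insert a I)" for x
  proof -
    have "{y \<in> supp_box n d I.
      (x, y) \<in> {(x, y). x \<in> supp_box n d (insert a I) \<and> y \<in> supp_box n d I \<and> y = x(a := 0)}}
      = {x(a := 0)}"
      using x down[OF x] by auto
    then show ?thesis by simp
  qed
  show "card {x \<in> supp_box n d (insert a I).
      (x, y) \<in> {(x, y). x \<in> supp_box n d (insert a I) \<and> y \<in> supp_box n d I \<and> y = x(a := 0)}} = d"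
    if y: "y \<in> supp_box n d I" for y
  proof -
    have ya: "y a = 0" using y a by (auto simp: supp_box_def)
    have "{x \<in> supp_box n d (insert a I).
      (x, y) \<in> {(x, y). x \<in> supp_box n d (insert a I) \<and> y \<in> supp_box n d I \<and> y = x(a := 0)}}
      = (\<lambda>t. y(a := t)) ` {1..d}"
    proof (intro equalityI subsetI)
      fix x assume "x \<in> {x \<in> supp_box n d (insert a I).
        (x, y) \<in> {(x, y). x \<in> supp_box n d (insert a I) \<and> y \<in> supp_box n d I \<and> y = x(a := 0)}}"
      then have x: "x \<in> supp_box n d (insert a I)" "y = x(a := 0)" by auto
      then have "if a \<in> insert a I then x a \<in> {1..d} else x a = 0"
        using a(1) unfolding supp_box_def by blast
      then have "x a \<in> {1..d}" by simp
      moreover have "x = y(a := x a)" using x(2) by simp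
      ultimately show "x \<in> (\<lambda>t. y(a := t)) ` {1..d}" by blast
    next
      fix x assume "x \<in> (\<lambda>t. y(a := t)) ` {1..d}"
      then obtain t where t: "t \<in> {1..d}" "x = y(a := t)" by blast
      have "x \<in> supp_box n d (insert a I)"
        using y t a unfolding t(2)
        by (auto simp: supp_box_def cube_def PiE_iff extensional_def split: if_splits)
      then show "x \<in> {x \<in> supp_box n d (insert a I).
        (x, y) \<in> {(x, y). x \<in> supp_box n d (insert a I) \<and> y \<in> supp_box n d I \<and> y = x(a := 0)}}"
        using y ya t by (auto simp: fun_upd_idem)
    qed
    moreover have "inj_on (\<lambda>t. y(a := t)) {1..d}"
      by (intro inj_onI) (metis fun_upd_same)
    ultimately show ?thesis by (simp add: card_image)
  qed
  show "\<bar>f x - f y\<bar> \<le> C"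
    if "(x, y) \<in> {(x, y). x \<in> supp_box n d (insert a I) \<and> y \<in> supp_box n d I \<and> y = x(a := 0)}" for x y
    using that lip[OF a(1), of x 0] by (auto simp: supp_box_def)
qed (use d C finite_supp_box in auto)

lemma avg_supp_box_swap:
  assumes d: "1 \<le> d" and IJ: "I \<in> nsets {1..n-1} k" "J \<in> nsets {1..n-1} k" "card (sym_diff I J) = 2"
    and C: "0 \<le> C"
    and lip: "\<And>i x y. i \<in> {1..n-1} \<Longrightarrow> x \<in> cube n d \<Longrightarrow> y \<in> {0..d} \<Longrightarrow> \<bar>f x - f (x(i := y))\<bar> \<le> C"
  shows "\<bar>avg (supp_box n d I) f - avg (supp_box n d J) f\<bar> \<le> 2 * C"
proof -
  have IJ': "I \<subseteq> {1..n-1}" "finite I" "card I = k" "J \<subseteq> {1..n-1}" "finite J" "card J = k"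
    using IJ by (auto simp: nsets_def)
  have "card (sym_diff I J) = card (I - J) + card (J - I)"
    using IJ' by (intro card_Un_disjoint) auto
  moreover have "card (I - J) = card (J - I)"
    using card_Int_Diff[of I J] card_Int_Diff[of J I] IJ' by (simp add: Int_commute)
  ultimately have "card (I - J) = 1" "card (J - I) = 1" using IJ(3) by auto
  then obtain a b where "I - J = {a}" "J - I = {b}" by (auto simp: card_1_singleton_iff)
  then have I: "I = insert a (I \<inter> J)" "a \<notin> I \<inter> J" "a \<in> {1..n-1}"
    and J: "J = insert b (I \<inter> J)" "b \<notin> I \<inter> J" "b \<in> {1..n-1}" using IJ' by auto
  have "\<bar>avg (supp_box n d I) f - avg (supp_box n d (I \<inter> J)) f\<bar> \<le> C"
    by (subst I(1), rule avg_supp_box_insert[OF d I(3,2) C lip])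
  moreover have "\<bar>avg (supp_box n d J) f - avg (supp_box n d (I \<inter> J)) f\<bar> \<le> C"
    by (subst J(1), rule avg_supp_box_insert[OF d J(3,2) C lip])
  ultimately show ?thesis by linarith
qed

section \<open>The number of nonzero coordinates\<close>

text \<open>The vectors of \<open>SB n d\<close> with exactly \<open>k\<close> nonzero coordinates.\<close>
definition SB_level :: "nat \<Rightarrow> nat \<Rightarrow> nat \<Rightarrow> (nat \<Rightarrow> nat) set" where
  "SB_level n d k = {x \<in> SB n d. card (supp n x) = k}"

lemma supp_SB_level:
  assumes "x \<in> SB_level n d k"
  shows "supp n x \<in> {S \<in> nsets {1..n-1} k. nonadjacent S}"
  using assms by (auto simp: SB_level_def SB_altdef nsets_def supp_def)

lemma finite_SB_level: "finite (SB_level n d k)"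
  unfolding SB_level_def using finite_SB by simp

lemma finite_nonadjacent_nsets: "finite A \<Longrightarrow> finite {S \<in> nsets A k. nonadjacent S}"
  using finite_imp_finite_nsets[of A k] by simp

lemma SB_level_fibre:
  assumes "T \<in> {S \<in> nsets {1..n-1} k. nonadjacent S}"
  shows "{x \<in> SB_level n d k. supp n x = T} = supp_box n d T"
proof -
  have "{x \<in> SB_level n d k. supp n x = T} = {x \<in> SB n d. supp n x = T}"
    using assms by (auto simp: SB_level_def nsets_def)
  also have "\<dots> = supp_box n d T"
    using assms by (intro SB_supp_fibre) (auto simp: nsets_def)
  finally show ?thesis .
qed

lemma card_SB_level_fibre:
  assumes "T \<in> {S \<in> nsets {1..n-1} k. nonadjacent S}"
  shows "card {x \<in> SB_level n d k. supp n x = T} = d ^ k"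
  unfolding SB_level_fibre[OF assms] using assms by (subst card_supp_box) (auto simp: nsets_def)

lemma card_SB_level:
  assumes "k \<le> n"
  shows "card (SB_level n d k) = d ^ k * (n - k choose k)"
proof -
  let ?T = "{S \<in> nsets {1..n-1} k. nonadjacent S}"
  have "card (SB_level n d k) = (\<Sum>T\<in>?T. \<Sum>x\<in>{x \<in> SB_level n d k. supp n x = T}. 1)"
    unfolding card_eq_sum
    by (rule sum.group[symmetric]) (use supp_SB_level finite_SB_level finite_nonadjacent_nsets in auto)
  also have "\<dots> = (\<Sum>T\<in>?T. d ^ k)"
    by (intro sum.cong refl) (simp only: card_eq_sum[symmetric] card_SB_level_fibre)
  also have "\<dots> = d ^ k * card ?T" by simp
  also have "card ?T = card (nsets {1..n-k} k)"
    using bij_betw_same_card[OF bij_betw_tau[OF assms]] by simp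
  finally show ?thesis by simp
qed

lemma card_supp_SB:
  assumes "x \<in> SB n d"
  shows "card (supp n x) \<le> n div 2"
proof -
  let ?k = "card (supp n x)"
  have "?k \<le> card {1..n-1}" by (intro card_mono) (auto simp: supp_def)
  then have "?k \<le> n" by simp
  have "x \<in> SB_level n d ?k" using assms by (simp add: SB_level_def)
  then have "supp n x \<in> tau ` nsets {1..n-?k} ?k"
    using supp_SB_level bij_betw_imp_surj_on[OF bij_betw_tau[OF \<open>?k \<le> n\<close>]] by blast
  then have "nsets {1..n-?k} ?k \<noteq> {}" by blast
  then have "?k \<le> n - ?k" by (simp add: nsets_eq_empty_iff not_less)
  then show ?thesis by linarith
qed

lemma choose_Suc_mult:
  assumes "k \<le> N"
  shows "real (N choose (k + 1)) * (real k + 1) = real (N choose k) * (real N - real k)"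
proof -
  have "Suc k * (N choose Suc k) = (N - k) * (N choose k)"
    using binomial_absorb_comp[of N k] binomial_absorption[of k N] by simp
  then have "real (Suc k * (N choose Suc k)) = real ((N - k) * (N choose k))" by (rule arg_cong)
  then show ?thesis using assms by (simp add: of_nat_diff algebra_simps)
qed

lemma choose_step:
  assumes "2 * (k + 1) \<le> n"
  shows "real (n - (k + 1) choose (k + 1)) * (real k + 1) * (real n - real k)
       = real (n - k choose k) * (real n - 2 * real k) * (real n - 2 * real k - 1)"
proof -
  define a where "a = n - (k + 1)"
  have a: "n - k = Suc a" "k \<le> a" "real n = real a + real k + 1"
    using assms by (auto simp: a_def)
  have "(Suc a - k) * (Suc a choose k) = Suc a * (a choose k)"
    using binomial_absorb_comp[of "Suc a" k] by simp
  then have "real ((Suc a - k) * (Suc a choose k)) = real (Suc a * (a choose k))" by (rule arg_cong)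
  moreover have "real (Suc a - k) = real a + 1 - real k" "real (Suc a) = real a + 1"
    using a(2) by auto
  ultimately have "(real a + 1 - real k) * real (Suc a choose k) = (real a + 1) * real (a choose k)"
    by (simp only: of_nat_mult)
  with choose_Suc_mult[OF a(2)] show ?thesis
    unfolding a(1) a_def[symmetric] a(3) by algebra
qed

text \<open>The quotient \<open>q\<close> of the level sizes by the binomial coefficients of \<open>N = n div 2\<close> is log-concave:
  its successive ratios are \<open>2 d (2 (N - k) + s) / (n - k)\<close> with a sign \<open>s\<close> depending on the parity
  of \<open>n\<close>, and these decrease in \<open>k\<close>.\<close>
lemma card_SB_level_ultra_log_concave:
  fixes n d :: nat
  assumes d: "1 \<le> d"
  defines "N \<equiv> n div 2"
  defines "q \<equiv> \<lambda>k. real (d ^ k * (n - k choose k)) / real (N choose k)"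
  shows "\<And>k. k \<le> N \<Longrightarrow> 0 < q k"
    and "\<And>k. k + 2 \<le> N \<Longrightarrow> q k * q (k + 2) \<le> (q (k + 1))\<^sup>2"
proof -
  show pos: "0 < q k" if "k \<le> N" for k
    using that d by (auto simp: q_def N_def intro!: divide_pos_pos mult_pos_pos)
  define s :: real where "s = (if even n then - 1 else 1)"
  define g where "g k = 2 * real d * (2 * (real N - real k) + s) / (real n - real k)" for k
  have step: "q (k + 1) = q k * g k" if k: "k + 1 \<le> N" for k
  proof -
    have n: "real n = 2 * real N + (1 + s) / 2"
      by (cases "even n") (auto simp: N_def s_def elim!: evenE oddE)
    have kn: "2 * (k + 1) \<le> n" using k by (simp add: N_def)
    have a: "real (N choose (k + 1)) * (real k + 1) = real (N choose k) * (real N - real k)"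
      using k by (intro choose_Suc_mult) simp
    have b: "(real n - 2 * real k) * (real n - 2 * real k - 1)
        = 2 * (real N - real k) * (2 * (real N - real k) + s)"
      unfolding n by (cases "even n") (simp_all add: s_def algebra_simps)
    have nz: "real n - real k \<noteq> 0" "real (N choose k) \<noteq> 0" "real (N choose (k + 1)) \<noteq> 0"
      "real N - real k \<noteq> 0" "real k + 1 \<noteq> 0"
      using k kn by auto
    let ?P = "real (n - (k + 1) choose (k + 1))" and ?Q = "real (n - k choose k)"
    have "?P * (real k + 1) * (real n - real k) = ?Q * (2 * (real N - real k) * (2 * (real N - real k) + s))"
      using choose_step[OF kn] b by (simp only: mult.assoc)
    then have "?P * (real n - real k) * real (N choose k) * ((real k + 1) * (real N - real k))
      = ?Q * 2 * (2 * (real N - real k) + s) * real (N choose (k + 1)) * ((real k + 1) * (real N - real k))"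
      using a by algebra
    then have "?P * (real n - real k) * real (N choose k)
      = ?Q * 2 * (2 * (real N - real k) + s) * real (N choose (k + 1))"
      using nz by simp
    then show ?thesis
      using nz by (simp add: q_def g_def divide_simps mult_ac)
  qed
  show "q k * q (k + 2) \<le> (q (k + 1))\<^sup>2" if k: "k + 2 \<le> N" for k
  proof -
    have kn: "2 * (k + 2) \<le> n" using k by (simp add: N_def)
    have "g (k + 1) \<le> g k"
    proof -
      have "2 * real N + s \<le> real n * 2"
        unfolding s_def N_def by (cases "even n") (auto elim!: evenE oddE)
      then have "(2 * (real N - real (k + 1)) + s) * (real n - real k)
          \<le> (2 * (real N - real k) + s) * (real n - real (k + 1))"
        by (simp add: algebra_simps)
      then have "(2 * (real N - real (k + 1)) + s) / (real n - real (k + 1))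
          \<le> (2 * (real N - real k) + s) / (real n - real k)"
        using kn by (simp add: divide_simps mult_ac)
      then have "2 * real d * ((2 * (real N - real (k + 1)) + s) / (real n - real (k + 1)))
          \<le> 2 * real d * ((2 * (real N - real k) + s) / (real n - real k))"
        by (intro mult_left_mono) auto
      then show ?thesis by (simp add: g_def)
    qed
    then have "q k * (q (k + 1) * g (k + 1)) \<le> q k * (q (k + 1) * g k)"
      using pos[of k] pos[of "k + 1"] k by (intro mult_left_mono) auto
    then show ?thesis
      using step[of k] step[of "k + 1"] k by (simp add: power2_eq_square mult_ac)
  qed
qed

lemma sub_gaussian_card_supp:
  assumes "2 \<le> n" "1 \<le> d"
  shows "sub_gaussian (SB n d) (\<lambda>x. real (card (supp n x))) (real (n div 2) / 8)"
proof (rule sub_gaussian_ultra_log_concave[OF finite_SB card_supp_SB _ _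
      card_SB_level_ultra_log_concave[OF assms(2), of _ n]])
  show "1 \<le> n div 2" using assms by simp
  fix k assume "k \<le> n div 2"
  then show "real (card {x \<in> SB n d. card (supp n x) = k})
      = real (n div 2 choose k) * (real (d ^ k * (n - k choose k)) / real (n div 2 choose k))"
    using card_SB_level[of k n d] by (simp add: SB_level_def)
qed auto

section \<open>Combining the three sources of fluctuation\<close>

text \<open>A function with bounded differences \<open>C\<close>, for which also the conditional mean given the support
  changes by at most \<open>2 C\<close> when, in terms of the unshifted set \<open>I\<close>, one element is exchanged.\<close>
locale shift_regular =
  fixes n d :: nat and f :: "(nat \<Rightarrow> nat) \<Rightarrow> real" and C :: real
  assumes n: "2 \<le> n" and d: "1 \<le> d" and C: "0 \<le> C"
    and lip: "\<And>i x y. i \<in> {1..n-1} \<Longrightarrow> x \<in> cube n d \<Longrightarrow> y \<in> {0..d} \<Longrightarrow> \<bar>f x - f (x(i := y))\<bar> \<le> C"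
    and swap: "\<And>k. k \<le> n div 2 \<Longrightarrow>
      swap_lipschitz {1..n-k} k (\<lambda>I. avg (supp_box n d (tau I)) f) (2 * C)"
begin

text \<open>The conditional mean of \<open>f\<close> given the support.\<close>
definition box_mean :: "nat set \<Rightarrow> real" where
  "box_mean S = avg (supp_box n d S) f"

text \<open>The conditional mean of \<open>f\<close> given that there are \<open>k\<close> nonzero coordinates, see \<open>avg_SB_level\<close>.\<close>
definition level_mean :: "nat \<Rightarrow> real" where
  "level_mean k = avg (nsets {1..n-k} k) (box_mean \<circ> tau)"

lemma swap': "k \<le> n div 2 \<Longrightarrow> swap_lipschitz {1..n-k} k (box_mean \<circ> tau) (2 * C)"
  using swap by (simp add: box_mean_def comp_def)

lemma sub_gaussian_supp_box: "sub_gaussian (supp_box n d S) f (real n * (C\<^sup>2 / 8))"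
proof -
  have "sub_gaussian (supp_box n d S) f (real (card {1..n-1}) * (C\<^sup>2 / 8))"
    unfolding supp_box_eq_PiE
  proof (rule sub_gaussian_PiE)
    fix x i y
    assume x: "x \<in> Pi\<^sub>E {1..n-1} (\<lambda>i. if i \<in> S then {1..d} else {0})" and i: "i \<in> {1..n-1}"
      and y: "y \<in> (if i \<in> S then {1..d} else {0})"
    have "x \<in> cube n d"
      using x unfolding supp_box_eq_PiE[symmetric] by (simp add: supp_box_def)
    moreover have "y \<in> {0..d}" using y by (auto split: if_splits)
    ultimately show "\<bar>f x - f (x(i := y))\<bar> \<le> C" using i lip by blast
  qed (use C in auto)
  moreover have "real (card {1..n-1}) * (C\<^sup>2 / 8) \<le> real n * (C\<^sup>2 / 8)"
    by (intro mult_right_mono) auto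
  ultimately show ?thesis by (rule sub_gaussian_mono)
qed

lemma SB_level_fibre_avg:
  "x \<in> SB_level n d k \<Longrightarrow> avg {y \<in> SB_level n d k. supp n y = supp n x} f = box_mean (supp n x)"
  using SB_level_fibre[OF supp_SB_level] by (simp add: box_mean_def)

lemma avg_SB_level:
  assumes "k \<le> n"
  shows "avg (SB_level n d k) f = level_mean k"
proof -
  have "avg (SB_level n d k) f = avg (SB_level n d k) (\<lambda>x. avg {y \<in> SB_level n d k. supp n y = supp n x} f)"
    by (rule avg_fibres[OF finite_SB_level])
  also have "\<dots> = avg (SB_level n d k) (box_mean \<circ> supp n)"
    by (intro avg_cong) (auto simp: SB_level_fibre_avg)
  also have "\<dots> = avg {S \<in> nsets {1..n-1} k. nonadjacent S} box_mean"
    by (rule avg_equidistributed[where c = "d ^ k"])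
      (use d supp_SB_level finite_SB_level card_SB_level_fibre finite_nonadjacent_nsets in auto)
  also have "\<dots> = level_mean k"
    unfolding level_mean_def by (rule avg_bij[OF bij_betw_tau[OF assms]])
  finally show ?thesis .
qed

text \<open>Given the number of nonzero coordinates, \<open>f\<close> fluctuates with the support, which is the shift of a
  uniform \<open>k\<close>-subset of \<open>{1..n-k}\<close>, and within the box of vectors with that support.\<close>
lemma sub_gaussian_SB_level:
  assumes k: "k \<le> n div 2"
  shows "sub_gaussian (SB_level n d k) f (real n * (5 * C\<^sup>2 / 8))"
proof -
  have kn: "k \<le> n" using k by simp
  have "sub_gaussian (SB_level n d k) f (real n * (C\<^sup>2 / 8) + real n * ((2 * C)\<^sup>2 / 8))"
  proof (rule sub_gaussian_tower[where \<pi> = "supp n", OF finite_SB_level])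
    show "sub_gaussian {y \<in> SB_level n d k. supp n y = supp n x} f (real n * (C\<^sup>2 / 8))"
      if "x \<in> SB_level n d k" for x
      unfolding SB_level_fibre[OF supp_SB_level[OF that]] by (rule sub_gaussian_supp_box)
    have "sub_gaussian (nsets {1..n-k} k) (box_mean \<circ> tau) (real (card {1..n-k}) * ((2 * C)\<^sup>2 / 8))"
      using C swap'[OF k] by (intro sub_gaussian_nsets) auto
    then have "sub_gaussian (nsets {1..n-k} k) (box_mean \<circ> tau) (real n * ((2 * C)\<^sup>2 / 8))"
      by (rule sub_gaussian_mono) (intro mult_right_mono, auto)
    then have "sub_gaussian {S \<in> nsets {1..n-1} k. nonadjacent S} box_mean (real n * ((2 * C)\<^sup>2 / 8))"
      by (rule sub_gaussian_bij[OF bij_betw_tau[OF kn]])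
    then have "sub_gaussian (SB_level n d k) (box_mean \<circ> supp n) (real n * ((2 * C)\<^sup>2 / 8))"
      by (intro sub_gaussian_equidistributed[where c = "d ^ k" and T = "{S \<in> nsets {1..n-1} k. nonadjacent S}"])
        (use d supp_SB_level finite_SB_level card_SB_level_fibre finite_nonadjacent_nsets in auto)
    then show "sub_gaussian (SB_level n d k) (\<lambda>x. avg {y \<in> SB_level n d k. supp n y = supp n x} f)
        (real n * ((2 * C)\<^sup>2 / 8))"
      unfolding sub_gaussian_def by (simp only: SB_level_fibre_avg comp_def simp_thms cong: avg_cong)
  qed
  then show ?thesis
    by (rule sub_gaussian_mono) (simp add: power2_eq_square algebra_simps)
qed

text \<open>Let \<open>m = n - k - 1\<close>. Two exchanges force a random \<open>k\<close>-subset \<open>I\<close> of \<open>{1..m+1}\<close> into \<open>{1..<m}\<close>.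
  Then \<open>insert m I\<close> is a \<open>(k+1)\<close>-subset of \<open>{1..m}\<close>, and its shift has just the point \<open>n - 1\<close> in
  addition to the shift of \<open>I\<close>; this costs one change of a coordinate of \<open>f\<close>. One more exchange
  removes the condition that the new set contains \<open>m\<close>. In total, this costs \<open>4 C + C + 2 C\<close>.\<close>
lemma level_mean_step:
  assumes k: "k + 1 \<le> n div 2"
  shows "\<bar>level_mean k - level_mean (k + 1)\<bar> \<le> 7 * C"
proof -
  define m where "m = n - k - 1"
  define A where "A = {1..<m}"
  have m: "2 \<le> n" "m + k = n - 1" "k < m" "n - k = Suc m" using k by (auto simp: m_def)
  have A: "finite A" "m \<notin> A" "Suc m \<notin> insert m A" "k \<le> card A" using m by (auto simp: A_def)
  have mA: "{1..m} = insert m A" using m(3) by (auto simp: A_def)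
  have top: "{1..n-k} = insert (Suc m) (insert m A)"
    unfolding m(4) mA[symmetric] by (rule atLeastAtMostSuc_conv) simp
  have top': "{1..n-(k+1)} = insert m A"
    using mA by (simp add: m_def)
  let ?G = "box_mean \<circ> tau"
  have C2: "0 \<le> 2 * C" using C by simp
  have lip_k: "swap_lipschitz (insert (Suc m) (insert m A)) k ?G (2 * C)"
    using swap'[of k] k unfolding top by simp
  then have "swap_lipschitz (insert m A) k ?G (2 * C)"
    by (rule swap_lipschitz_subset) auto
  moreover have "k \<le> card (insert m A)" using A by simp
  moreover have lip_Suc: "swap_lipschitz (insert m A) (Suc k) ?G (2 * C)"
    using swap'[of "k + 1"] k unfolding top' by simp
  ultimately have
    1: "\<bar>avg (nsets (insert (Suc m) (insert m A)) k) ?G - avg (nsets (insert m A) k) ?G\<bar> \<le> 2 * C" and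
    2: "\<bar>avg (nsets (insert m A) k) ?G - avg (nsets A k) ?G\<bar> \<le> 2 * C" and
    4: "\<bar>avg (nsets (insert m A) (Suc k)) ?G - avg (nsets A k) (?G \<circ> insert m)\<bar> \<le> 2 * C"
    using A C2 lip_k by (auto intro!: avg_nsets_remove avg_nsets_contain simp del: insert_iff)
  have 3: "\<bar>avg (nsets A k) (?G \<circ> insert m) - avg (nsets A k) ?G\<bar> \<le> C"
  proof (rule avg_abs_diff_le[OF C])
    fix I assume "I \<in> nsets A k"
    then have I: "I \<subseteq> A" "finite I" "card I = k" by (auto simp: nsets_def)
    then have "\<And>x. x \<in> I \<Longrightarrow> x < m" by (auto simp: A_def)
    then have "tau (insert m I) = insert (n - 1) (tau I)"
      using tau_insert_top[of I m] I m(2) by simp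
    moreover have "n - 1 \<notin> tau I"
    proof -
      have "shift_up I x < n - 1" if "x \<in> I" for x
      proof -
        have "card {y \<in> I. y < x} \<le> k" using I by (auto intro!: card_mono)
        moreover have "x < m" using that I by (auto simp: A_def)
        ultimately show ?thesis using m(2) by (simp add: shift_up_def)
      qed
      then show ?thesis unfolding tau_eq_shift_up[OF I(2)] by force
    qed
    moreover have "n - 1 \<in> {1..n-1}" using m by auto
    ultimately show "\<bar>(?G \<circ> insert m) I - ?G I\<bar> \<le> C"
      using avg_supp_box_insert[where f = f and a = "n - 1" and I = "tau I", OF d _ _ C lip] by (simp add: box_mean_def)
  qed
  show ?thesis
    using 1 2 3 4 unfolding level_mean_def top top' by auto
qed

lemma level_mean_lipschitz:
  assumes "k \<le> n div 2" "k' \<le> n div 2"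
  shows "\<bar>level_mean k - level_mean k'\<bar> \<le> 7 * C * \<bar>real k - real k'\<bar>"
proof -
  have *: "\<bar>level_mean k - level_mean k'\<bar> \<le> 7 * C * (real k' - real k)" if "k \<le> k'" "k' \<le> n div 2" for k k'
    using that
  proof (induction k' rule: dec_induct)
    case (step j)
    then have "\<bar>level_mean k - level_mean j\<bar> \<le> 7 * C * (real j - real k)"
      "\<bar>level_mean j - level_mean (Suc j)\<bar> \<le> 7 * C"
      using level_mean_step[of j] by auto
    then show ?case by (simp add: algebra_simps)
  qed simp
  show ?thesis
    using *[of k k'] *[of k' k] assms by (cases "k \<le> k'") (auto simp: abs_minus_commute)
qed

lemma sub_gaussian_SB: "sub_gaussian (SB n d) f (7 * real n * C\<^sup>2)"
proof -
  have level: "{y \<in> SB n d. card (supp n y) = card (supp n x)} = SB_level n d (card (supp n x))" for x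
    by (simp add: SB_level_def)
  have "sub_gaussian (SB n d) f (real n * (5 * C\<^sup>2 / 8) + 2 * (7 * C)\<^sup>2 * (real (n div 2) / 8))"
  proof (rule sub_gaussian_tower[where \<pi> = "\<lambda>x. card (supp n x)", OF finite_SB])
    show "sub_gaussian {y \<in> SB n d. card (supp n y) = card (supp n x)} f (real n * (5 * C\<^sup>2 / 8))"
      if "x \<in> SB n d" for x
      unfolding level using card_supp_SB[OF that] by (rule sub_gaussian_SB_level)
    show "sub_gaussian (SB n d) (\<lambda>x. avg {y \<in> SB n d. card (supp n y) = card (supp n x)} f)
        (2 * (7 * C)\<^sup>2 * (real (n div 2) / 8))"
    proof (rule sub_gaussian_lipschitz[OF _ _ sub_gaussian_card_supp[OF n d]])
      fix x y assume "x \<in> SB n d" "y \<in> SB n d"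
      then have xy: "card (supp n x) \<le> n div 2" "card (supp n y) \<le> n div 2"
        using card_supp_SB by auto
      then show "\<bar>avg {z \<in> SB n d. card (supp n z) = card (supp n x)} f
          - avg {z \<in> SB n d. card (supp n z) = card (supp n y)} f\<bar>
          \<le> 7 * C * \<bar>real (card (supp n x)) - real (card (supp n y))\<bar>"
        unfolding level using level_mean_lipschitz[OF xy] by (simp add: avg_SB_level)
    qed (use C in simp)
  qed
  moreover have "real n * (5 * C\<^sup>2 / 8) + 2 * (7 * C)\<^sup>2 * (real (n div 2) / 8) \<le> 7 * real n * C\<^sup>2"
  proof -
    have "real (n div 2) \<le> real n / 2" by linarith
    then have "C\<^sup>2 * real (n div 2) \<le> C\<^sup>2 * (real n / 2)" by (intro mult_left_mono) auto
    moreover have "0 \<le> C\<^sup>2 * real n" by simp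
    moreover have "real n * (5 * C\<^sup>2 / 8) + 2 * (7 * C)\<^sup>2 * (real (n div 2) / 8)
        = 5 / 8 * (C\<^sup>2 * real n) + 49 / 4 * (C\<^sup>2 * real (n div 2))"
      by (simp add: power_mult_distrib)
    moreover have "7 * real n * C\<^sup>2 = 7 * (C\<^sup>2 * real n)" by simp
    moreover have "C\<^sup>2 * (real n / 2) = 1 / 2 * (C\<^sup>2 * real n)" by simp
    ultimately show ?thesis by linarith
  qed
  ultimately show ?thesis by (rule sub_gaussian_mono)
qed

end

theorem theorem1p5:
  shows "\<exists>K::real. K > 0 \<and>
    (\<forall>(n::nat) (d::nat) (f :: (nat \<Rightarrow> nat) \<Rightarrow> real) (C1::real) (C2::real).
      n \<ge> 2 \<longrightarrow> d \<ge> 1 \<longrightarrow> C1 \<ge> 0 \<longrightarrow> C2 \<ge> 0 \<longrightarrow> C1 + C2 > 0 \<longrightarrow>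
      (\<forall>i\<in>{1..n-1}. \<forall>x\<in>cube n d. \<forall>y\<in>{0..d}. \<bar>f x - f (x(i := y))\<bar> \<le> C1) \<longrightarrow>
      (\<forall>k\<le>n div 2. \<forall>I\<in>nsets {1..n-k} k. \<forall>J\<in>nsets {1..n-k} k.
          card (sym_diff I J) = 2 \<longrightarrow>
          \<bar>(unif_expectation (supp_box n d I) f - unif_expectation (supp_box n d (tau I)) f)
            - (unif_expectation (supp_box n d J) f - unif_expectation (supp_box n d (tau J)) f)\<bar>
          \<le> C2) \<longrightarrow>
      (\<forall>r>0. unif_prob (SB n d) (\<lambda>x. \<bar>f x - unif_expectation (SB n d) f\<bar> \<ge> r)
          \<le> 2 * exp (- (r\<^sup>2 / (real n * K * (C1 + C2)\<^sup>2)))))"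
proof (intro exI[of _ 28] conjI allI impI)
  fix n d :: nat and f :: "(nat \<Rightarrow> nat) \<Rightarrow> real" and C1 C2 r :: real
  assume n: "2 \<le> n" and d: "1 \<le> d" and C12: "0 \<le> C1" "0 \<le> C2" and pos: "0 < C1 + C2" and r: "0 < r"
    and lip: "\<forall>i\<in>{1..n-1}. \<forall>x\<in>cube n d. \<forall>y\<in>{0..d}. \<bar>f x - f (x(i := y))\<bar> \<le> C1"
    and swap: "\<forall>k\<le>n div 2. \<forall>I\<in>nsets {1..n-k} k. \<forall>J\<in>nsets {1..n-k} k.
          card (sym_diff I J) = 2 \<longrightarrow>
          \<bar>(unif_expectation (supp_box n d I) f - unif_expectation (supp_box n d (tau I)) f)
            - (unif_expectation (supp_box n d J) f - unif_expectation (supp_box n d (tau J)) f)\<bar>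
          \<le> C2"
  have unif: "unif_expectation (supp_box n d I) f = avg (supp_box n d I) f" for I
    by (intro unif_expectation_eq_avg finite_supp_box supp_box_nonempty d)
  interpret shift_regular n d f "C1 + C2"
  proof
    show "2 \<le> n" "1 \<le> d" "0 \<le> C1 + C2" using n d pos by auto
    show "\<bar>f x - f (x(i := y))\<bar> \<le> C1 + C2"
      if "i \<in> {1..n-1}" "x \<in> cube n d" "y \<in> {0..d}" for i x y
      using lip that C12 by force
    show "swap_lipschitz {1..n-k} k (\<lambda>I. avg (supp_box n d (tau I)) f) (2 * (C1 + C2))"
      if k: "k \<le> n div 2" for k
      unfolding swap_lipschitz_def
    proof (intro ballI impI)
      fix I J assume IJ: "I \<in> nsets {1..n-k} k" "J \<in> nsets {1..n-k} k" "card (sym_diff I J) = 2"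
      have "k \<noteq> 0"
      proof
        assume "k = 0"
        then have "I = {}" "J = {}" using IJ by (auto simp: nsets_def)
        then show False using IJ(3) by simp
      qed
      then have "nsets {1..n-k} k \<subseteq> nsets {1..n-1} k" by (intro nsets_mono) auto
      then have IJ': "I \<in> nsets {1..n-1} k" "J \<in> nsets {1..n-1} k" using IJ by auto
      have "\<bar>avg (supp_box n d I) f - avg (supp_box n d J) f\<bar> \<le> 2 * C1"
        by (rule avg_supp_box_swap[OF d IJ' IJ(3) C12(1)]) (use lip in blast)
      moreover have "\<bar>(avg (supp_box n d I) f - avg (supp_box n d (tau I)) f)
            - (avg (supp_box n d J) f - avg (supp_box n d (tau J)) f)\<bar> \<le> C2"
        using swap k IJ unfolding unif by blast
      ultimately show "\<bar>avg (supp_box n d (tau I)) f - avg (supp_box n d (tau J)) f\<bar> \<le> 2 * (C1 + C2)"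
        using C12 by (auto simp: abs_le_iff)
    qed
  qed
  have ne: "SB n d \<noteq> {}"
  proof -
    have "card (SB_level n d 0) = 1" using card_SB_level[of 0 n d] by simp
    then show ?thesis by (auto simp: SB_level_def)
  qed
  have "unif_prob (SB n d) (\<lambda>x. r \<le> \<bar>f x - avg (SB n d) f\<bar>)
      \<le> 2 * exp (- (r\<^sup>2 / (4 * (7 * real n * (C1 + C2)\<^sup>2))))"
    using n pos r by (intro sub_gaussian_tail[OF finite_SB ne sub_gaussian_SB]) auto
  then show "unif_prob (SB n d) (\<lambda>x. \<bar>f x - unif_expectation (SB n d) f\<bar> \<ge> r)
          \<le> 2 * exp (- (r\<^sup>2 / (real n * 28 * (C1 + C2)\<^sup>2)))"
    unfolding unif_expectation_eq_avg[OF finite_SB ne] by (simp add: mult_ac)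
qed simp

end
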